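(* Let $g$ satisfy (UM) (see context) and let $g$ be a unimodal function, with a unique point $x_m\in(0,\kappa)$ of local extremum (maximum). Suppose further that $|g'(x)|<1$ for all $x\in[g(g(x_m)),g(x_m)]$. Let the initial function $w_0$ satisfy (IC1) and (IC2), let $c>c_\#$, $\lambda\in(\lambda_1(c),\lambda_2(c))$, and let $\phi$ be the profile of the semi-wavefront with speed $c$ (which under these hypotheses is a wavefront). If $$\sup_{s\in[-h,0]}|\phi(\cdot+cs)-w_0(s,\cdot)|_\lambda<\infty,$$ then the solution $u(t,x)$ of $u_t=u_{xx}-u+g(u(t-h,x))$ ($t>0,\ x\in\mathbb{R}$), $u(s,x)=w_0(s,x)$ for $(s,x)\in[-h,0]\times\mathbb{R}$, converges uniformly to the wavefront $\phi(x+ct)$; more precisely, there are positive $\rho,\gamma$ such that $$\sup_{x\in\mathbb{R}}\frac{|u(t,x)-\phi(x+ct)|}{\eta_\lambda(x+ct)}\le0.5\,\rho\, e^{-\gamma t},\qquad t\ge0.$$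
   Context: $h>0$ is a fixed delay. Hypothesis (H): $g:\mathbb{R}_+\to\mathbb{R}_+$ is continuous; $g(x)=x$ has exactly two nonnegative solutions, $0$ and $\kappa>0$; $g$ is $C^1$ in some $\delta_0$-neighbourhood of $0,\kappa$, with $g'(0)>1$, $g'(\kappa)<1$; $|g(u)-g(v)|\le L_g|u-v|$ for all $u,v\ge0$; and there are $C>0$, $\theta\in(0,1]$ with $|g'(u)-g'(0)|\le Cu^\theta$ for $u\in(0,\delta_0]$. ($g$ is extended linearly and $C^1$-smoothly to $(-\infty,0]$.) Hypothesis (UM): (H) holds, $L_g=g'(0)$ and $g$ is bounded. Initial functions: $w_0:[-h,0]\times\mathbb{R}\to\mathbb{R}_+$ is continuous and locally H\"older continuous in $x$ uniformly with respect to $s\in[-h,0]$. (IC1): $0\le w_0(s,x)\le\sup w_0<\infty$. (IC2): $\liminf_{x\to+\infty}\min_{s\in[-h,0]}w_0(s,x)>0$. Solution: the unique classical solution, continuous on $[-h,\infty)\times\mathbb{R}$, bounded on finite time intervals, with continuous $u_t,u_x,u_{xx}$ for $t>0$. A semi-wavefront with speed $c$ is a solution $u(t,x)=\phi(x+ct)$ with $\phi$ positive, bounded, smooth, $\phi(-\infty)=0$ and $\liminf_{x\to+\infty}\phi(x)>0$; it is a wavefront if moreover $\phi(+\infty)=\kappa$. Let $\chi_0(\lambda)=\lambda^2-c\lambda-1+g'(0)e^{-\lambda ch}$; $c_\#$ is the unique value of $c$ for which $\chi_0$ has a double positive zero, and for $c\ge c_\#$, $\lambda_1(c)\le\lambda_2(c)$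 are the two real zeros of $\chi_0$ (counting multiplicity), both positive. Under (UM), for each $c\ge c_\#$ there is a semi-wavefront with speed $c$, unique up to translation (known). For $\lambda\ge0$: $\eta_\lambda(t)=\min\{e^{\lambda t},1\}$ and $|f|_\lambda=\sup_{t\in\mathbb{R}}|f(t)|/\eta_\lambda(t)$. *)

theory Defs
  imports "HOL-Analysis.Analysis"
begin

(* The nonlinearity is represented by its linear C^1 extension to the whole real line, so that
   g'(0) is the ordinary two-sided derivative; all other conditions concern [0,\<infinity>). *)
definition hyp_H :: "real \<Rightarrow> real \<Rightarrow> (real \<Rightarrow> real) \<Rightarrow> bool" where
  "hyp_H \<kappa> L g \<longleftrightarrow>
     continuous_on {0..} g \<and> (\<forall>x\<ge>0. g x \<ge> 0) \<and>
     (\<forall>x\<le>0. g x = deriv g 0 * x) \<and>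
     \<kappa> > 0 \<and> {x. x \<ge> 0 \<and> g x = x} = {0, \<kappa>} \<and>
     deriv g 0 > 1 \<and> deriv g \<kappa> < 1 \<and>
     (\<forall>u\<ge>0. \<forall>v\<ge>0. \<bar>g u - g v\<bar> \<le> L * \<bar>u - v\<bar>) \<and>
     (\<exists>\<delta>>0.
        (\<forall>x \<in> cball 0 \<delta> \<union> cball \<kappa> \<delta>. g field_differentiable (at x)) \<and>
        continuous_on (cball 0 \<delta> \<union> cball \<kappa> \<delta>) (deriv g) \<and>
        (\<exists>C>0. \<exists>\<theta>\<in>{0<..1}. \<forall>u\<in>{0<..\<delta>}. \<bar>deriv g u - deriv g 0\<bar> \<le> C * u powr \<theta>))"

definition hyp_UM :: "real \<Rightarrow> (real \<Rightarrow> real) \<Rightarrow> bool" where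
  "hyp_UM \<kappa> g \<longleftrightarrow> hyp_H \<kappa> (deriv g 0) g \<and> bounded (g ` {0..})"

definition local_max :: "(real \<Rightarrow> real) \<Rightarrow> real \<Rightarrow> bool" where
  "local_max f x \<longleftrightarrow> (\<forall>\<^sub>F y in at x. f y \<le> f x)"

definition local_min :: "(real \<Rightarrow> real) \<Rightarrow> real \<Rightarrow> bool" where
  "local_min f x \<longleftrightarrow> (\<forall>\<^sub>F y in at x. f x \<le> f y)"

(* For the extended g, the origin is not a local minimum, so the condition may range over the
   whole line. *)
definition unimodal_at :: "(real \<Rightarrow> real) \<Rightarrow> real \<Rightarrow> bool" where
  "unimodal_at g xm \<longleftrightarrow>
     local_max g xm \<and> (\<forall>x. local_max g x \<or> local_min g x \<longrightarrow> x = xm)"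

definition chi0 :: "real \<Rightarrow> (real \<Rightarrow> real) \<Rightarrow> real \<Rightarrow> real \<Rightarrow> real" where
  "chi0 h g c lam = lam\<^sup>2 - c * lam - 1 + deriv g 0 * exp (- lam * c * h)"

definition double_zero :: "(real \<Rightarrow> real) \<Rightarrow> real \<Rightarrow> bool" where
  "double_zero f z \<longleftrightarrow> f z = 0 \<and> deriv f z = 0 \<and> deriv (deriv f) z \<noteq> 0"

definition c_sharp :: "real \<Rightarrow> (real \<Rightarrow> real) \<Rightarrow> real" where
  "c_sharp h g = (THE c. \<exists>lam>0. double_zero (chi0 h g c) lam)"

(* chi0 is strictly convex when g'(0) > 0, so it has at most two real zeros; for c = c_sharp the
   two values coincide, in accordance with multiplicity. *)
definition lambda1 :: "real \<Rightarrow> (real \<Rightarrow> real) \<Rightarrow> real \<Rightarrow> real" where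
  "lambda1 h g c = Min {lam. chi0 h g c lam = 0}"

definition lambda2 :: "real \<Rightarrow> (real \<Rightarrow> real) \<Rightarrow> real \<Rightarrow> real" where
  "lambda2 h g c = Max {lam. chi0 h g c lam = 0}"

definition eta :: "real \<Rightarrow> real \<Rightarrow> real" where
  "eta lam t = min (exp (lam * t)) 1"

definition weighted_norm :: "real \<Rightarrow> (real \<Rightarrow> real) \<Rightarrow> ereal" where
  "weighted_norm lam f = (SUP t. ereal (\<bar>f t\<bar> / eta lam t))"

definition initial_function :: "real \<Rightarrow> (real \<Rightarrow> real \<Rightarrow> real) \<Rightarrow> bool" where
  "initial_function h w \<longleftrightarrow>
     (\<forall>s\<in>{-h..0}. \<forall>x. w s x \<ge> 0) \<and>
     continuous_on ({-h..0} \<times> UNIV) (\<lambda>(s, x). w s x) \<and>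
     (\<forall>R>0. \<exists>\<alpha>\<in>{0<..1}. \<exists>M. \<forall>s\<in>{-h..0}. \<forall>x\<in>{-R..R}. \<forall>y\<in>{-R..R}.
        \<bar>w s x - w s y\<bar> \<le> M * \<bar>x - y\<bar> powr \<alpha>)"

definition IC1 :: "real \<Rightarrow> (real \<Rightarrow> real \<Rightarrow> real) \<Rightarrow> bool" where
  "IC1 h w \<longleftrightarrow>
     (\<forall>s\<in>{-h..0}. \<forall>x. 0 \<le> w s x) \<and>
     (SUP (s, x) \<in> {-h..0} \<times> UNIV. ereal (w s x)) < \<infinity>"

(* The infimum over s is a minimum, since w is continuous. *)
definition IC2 :: "real \<Rightarrow> (real \<Rightarrow> real \<Rightarrow> real) \<Rightarrow> bool" where
  "IC2 h w \<longleftrightarrow> Liminf at_top (\<lambda>x. INF s\<in>{-h..0}. ereal (w s x)) > 0"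

definition classical_solution ::
    "real \<Rightarrow> (real \<Rightarrow> real) \<Rightarrow> (real \<Rightarrow> real \<Rightarrow> real) \<Rightarrow> bool" where
  "classical_solution h g u \<longleftrightarrow>
     continuous_on ({-h..} \<times> UNIV) (\<lambda>(t, x). u t x) \<and>
     (\<forall>T. bounded ((\<lambda>(t, x). u t x) ` ({-h..T} \<times> UNIV))) \<and>
     (\<exists>ut ux uxx.
        continuous_on ({0<..} \<times> UNIV) (\<lambda>(t, x). ut t x) \<and>
        continuous_on ({0<..} \<times> UNIV) (\<lambda>(t, x). ux t x) \<and>
        continuous_on ({0<..} \<times> UNIV) (\<lambda>(t, x). uxx t x) \<and>
        (\<forall>t>0. \<forall>x.
           ((\<lambda>t. u t x) has_real_derivative ut t x) (at t) \<and>
           ((\<lambda>x. u t x) has_real_derivative ux t x) (at x) \<and>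
           ((\<lambda>x. ux t x) has_real_derivative uxx t x) (at x) \<and>
           ut t x = uxx t x - u t x + g (u (t - h) x)))"

definition C2_smooth :: "(real \<Rightarrow> real) \<Rightarrow> bool" where
  "C2_smooth f \<longleftrightarrow>
     (\<exists>f' f''. (\<forall>x. (f has_real_derivative f' x) (at x)) \<and>
        (\<forall>x. (f' has_real_derivative f'' x) (at x)) \<and> continuous_on UNIV f'')"

(* Since g is not assumed to be differentiable everywhere, "smooth" means C^2.  For t > 0 and
   real x, the argument x + c t takes all real values, so the equation is imposed on the whole
   profile. *)
definition semi_wavefront ::
    "real \<Rightarrow> (real \<Rightarrow> real) \<Rightarrow> real \<Rightarrow> (real \<Rightarrow> real) \<Rightarrow> bool" where
  "semi_wavefront h g c \<phi> \<longleftrightarrow>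
     classical_solution h g (\<lambda>t x. \<phi> (x + c * t)) \<and>
     (\<forall>x. \<phi> x > 0) \<and> bounded (range \<phi>) \<and> C2_smooth \<phi> \<and>
     (\<phi> \<longlongrightarrow> 0) at_bot \<and> Liminf at_top (\<lambda>x. ereal (\<phi> x)) > 0"

definition wavefront ::
    "real \<Rightarrow> (real \<Rightarrow> real) \<Rightarrow> real \<Rightarrow> real \<Rightarrow> (real \<Rightarrow> real) \<Rightarrow> bool" where
  "wavefront h g \<kappa> c \<phi> \<longleftrightarrow> semi_wavefront h g c \<phi> \<and> (\<phi> \<longlongrightarrow> \<kappa>) at_top"

end

theory Submission
  imports Defs
begin

text \<open>
Write \<open>p t x = \<phi> (x + c * t)\<close>. Since \<open>p\<close> is itself a solution, everything concerns the difference
of two solutions of one equation, and every estimate is a comparison, with an explicit barrier,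
for the operator \<open>v_t - v_xx + v\<close>; the delayed term enters only as a source that is already known
from earlier times (\<open>comparison_principle\<close>).

At the rear of the wave only \<open>\<bar>g y - g z\<bar> \<le> g'(0) * \<bar>y - z\<bar>\<close> is available. The exponential
\<open>exp (lam * (x + c * t) - \<gamma> * t)\<close> is a supersolution of the corresponding linear equation for some
\<open>\<gamma> > 0\<close> because the characteristic function is negative strictly between its zeros
(\<open>chi0_neg_between_roots\<close>). So the difference decays like this exponential everywhere
(\<open>exponential_closeness_at_rear\<close>), which settles each half-line \<open>x + c * t \<le> z\<close>.

On the remaining half-lines \<open>x + c * t \<ge> z\<close> it suffices that both solutions eventually stay near
\<open>\<kappa>\<close>, where \<open>g\<close> is a contraction with a constant below one: constants times \<open>exp (- \<gamma> * t)\<close> are then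
supersolutions (\<open>exponential_closeness_everywhere\<close>). A solution has to approach \<open>\<kappa>\<close> as \<open>t\<close> and
\<open>x + c * t\<close> tend to infinity: its limits inferior \<open>m\<close> and superior \<open>M\<close> satisfy
\<open>min g \<le> m \<le> M \<le> max g\<close>, with extrema taken over \<open>[m, M]\<close>, since solutions relax to their source;
and for positive \<open>m\<close> the unimodal shape together with \<open>\<bar>g'\<bar> < 1\<close> on the core interval leaves only
\<open>m = M = \<kappa>\<close> (\<open>invariant_interval_trivial\<close>, \<open>converges_to_kappa_behind_front\<close>). Applied to \<open>p\<close>, this
says that the semi-wavefront is a wavefront.

For \<open>u\<close> the positivity of \<open>m\<close> has to be established (\<open>persistence\<close>). On a bounded range of
\<open>x + c * t\<close> the solution is close to the positive profile by the rear estimate, for large times.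
During one time interval of length \<open>h\<close> it is bounded below on a whole half-line, because the
positivity of the initial data far to the right spreads to the left at any speed
(\<open>expanding_front_lower_bound\<close>); afterwards a small constant is a subsolution there.
\<close>

section \<open>The parabolic operator and its comparison principle\<close>

text \<open>
The number \<open>r\<close> is the value of \<open>W_t - W_xx + W\<close> at \<open>(t, x)\<close>. It is a relation because \<open>W\<close> need be
differentiable only where a barrier argument looks at it.
\<close>

definition has_parabolic_value ::
    "(real \<Rightarrow> real \<Rightarrow> real) \<Rightarrow> real \<Rightarrow> real \<Rightarrow> real \<Rightarrow> bool" where
  "has_parabolic_value W t x r \<longleftrightarrow>
     (\<exists>wt wx wxx. ((\<lambda>s. W s x) has_real_derivative wt) (at t) \<and>
        (\<forall>y. (W t has_real_derivative wx y) (at y)) \<and>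
        (wx has_real_derivative wxx) (at x) \<and> r = wt - wxx + W t x)"

lemma has_parabolic_value_add:
  assumes "has_parabolic_value V t x r" "has_parabolic_value W t x s"
  shows "has_parabolic_value (\<lambda>t x. V t x + W t x) t x (r + s)"
proof -
  from assms(1) obtain vt vx vxx where v:
    "((\<lambda>s. V s x) has_real_derivative vt) (at t)"
    "\<And>y. (V t has_real_derivative vx y) (at y)"
    "(vx has_real_derivative vxx) (at x)" "r = vt - vxx + V t x"
    unfolding has_parabolic_value_def by blast
  from assms(2) obtain wt wx wxx where w:
    "((\<lambda>s. W s x) has_real_derivative wt) (at t)"
    "\<And>y. (W t has_real_derivative wx y) (at y)"
    "(wx has_real_derivative wxx) (at x)" "s = wt - wxx + W t x"
    unfolding has_parabolic_value_def by blast
  show ?thesis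
    unfolding has_parabolic_value_def
    by (intro exI[of _ "vt + wt"] exI[of _ "\<lambda>y. vx y + wx y"] exI[of _ "vxx + wxx"])
       (use v w in \<open>auto intro!: derivative_eq_intros\<close>)
qed

lemma has_parabolic_value_minus:
  assumes "has_parabolic_value V t x r"
  shows "has_parabolic_value (\<lambda>t x. - V t x) t x (- r)"
proof -
  from assms(1) obtain vt vx vxx where v:
    "((\<lambda>s. V s x) has_real_derivative vt) (at t)"
    "\<And>y. (V t has_real_derivative vx y) (at y)"
    "(vx has_real_derivative vxx) (at x)" "r = vt - vxx + V t x"
    unfolding has_parabolic_value_def by blast
  show ?thesis
    unfolding has_parabolic_value_def
    by (intro exI[of _ "- vt"] exI[of _ "\<lambda>y. - vx y"] exI[of _ "- vxx"])
       (use v in \<open>auto intro!: derivative_eq_intros\<close>)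
qed

lemma has_parabolic_value_diff:
  assumes "has_parabolic_value V t x r" "has_parabolic_value W t x s"
  shows "has_parabolic_value (\<lambda>t x. V t x - W t x) t x (r - s)"
  using has_parabolic_value_add[OF assms(1) has_parabolic_value_minus[OF assms(2)]] by simp

lemma has_parabolic_value_const: "has_parabolic_value (\<lambda>t x. k) t x k"
  unfolding has_parabolic_value_def
  by (intro exI[of _ 0] exI[of _ "\<lambda>_. 0"]) auto

text \<open>
The barriers below are sums of these exponentials. Along a wave of speed \<open>c\<close> one has
\<open>b = a * c - \<gamma>\<close>, and the factor is minus the delay-free part of the characteristic function at
\<open>a\<close>, reduced by \<open>\<gamma>\<close>.
\<close>

lemma has_parabolic_value_exp:
  "has_parabolic_value (\<lambda>t x. A * exp (a * x + b * t)) t x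
     ((b - a\<^sup>2 + 1) * (A * exp (a * x + b * t)))"
  unfolding has_parabolic_value_def
  by (intro exI[of _ "b * (A * exp (a * x + b * t))"]
        exI[of _ "\<lambda>x. a * (A * exp (a * x + b * t))"]
        exI[of _ "a\<^sup>2 * (A * exp (a * x + b * t))"])
     (auto intro!: derivative_eq_intros simp: algebra_simps power2_eq_square)

lemma second_derivative_nonneg_at_min:
  fixes f f' :: "real \<Rightarrow> real"
  assumes f: "\<And>y. (f has_real_derivative f' y) (at y)"
    and f': "(f' has_real_derivative l) (at x)"
    and e: "e > 0" and min: "\<And>y. \<bar>y - x\<bar> < e \<Longrightarrow> f x \<le> f y"
  shows "l \<ge> 0"
proof (rule ccontr)
  assume "\<not> l \<ge> 0"
  then have "l < 0" by simp
  have "f' x = 0"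
    using DERIV_local_min[OF f, of e] e min by (metis abs_minus_commute)
  obtain d where d: "d > 0" "\<And>k. 0 < k \<Longrightarrow> k < d \<Longrightarrow> f' (x + k) < f' x"
    using DERIV_neg_dec_right[OF f' \<open>l < 0\<close>] by blast
  define k where "k = min d e / 2"
  have k: "0 < k" "k < d" "k < e" using d e by (auto simp: k_def)
  have "\<exists>z>x. z < x + k \<and> f (x + k) - f x = (x + k - x) * f' z"
    using k by (intro MVT2) (auto intro: f)
  then obtain z where z: "z > x" "z < x + k" "f (x + k) - f x = k * f' z" by auto
  have "f' z < 0" using d(2)[of "z - x"] z k \<open>f' x = 0\<close> by auto
  then have "f (x + k) < f x" using z k mult_pos_neg[of k "f' z"] by linarith
  moreover have "f x \<le> f (x + k)" using min k by auto
  ultimately show False by simp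
qed

text \<open>
A negative value of \<open>W\<close> would persist after adding a small multiple of
\<open>exp (2 * (t - start)) * (1 + x\<^sup>2)\<close>, which makes the function large at spatial infinity, so that a
minimum is attained, and which has a strictly positive parabolic value. At a negative minimum the
time derivative is nonpositive and the second space derivative nonnegative, so the parabolic value
is negative, a contradiction. The condition is imposed only where \<open>W\<close> is negative; in this way
initial and lateral boundary values need no separate treatment.
\<close>

lemma comparison_principle_finite_time:
  fixes W :: "real \<Rightarrow> real \<Rightarrow> real"
  assumes closed: "closed D"
    and time: "\<And>t x. (t, x) \<in> D \<Longrightarrow> start \<le> t"
    and cont: "continuous_on D (\<lambda>(t, x). W t x)"
    and below: "\<And>t x. (t, x) \<in> D \<Longrightarrow> t \<le> T \<Longrightarrow> B \<le> W t x"
    and super: "\<And>t x. (t, x) \<in> D \<Longrightarrow> t \<le> T \<Longrightarrow> W t x < 0 \<Longrightarrow>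
        (t, x) \<in> interior D \<and> (\<exists>r\<ge>0. has_parabolic_value W t x r)"
    and "(t, x) \<in> D" "t \<le> T"
  shows "0 \<le> W t x"
proof (rule ccontr)
  assume neg: "\<not> 0 \<le> W t x"
  define q where "q = (\<lambda>t x::real. exp (2 * (t - start)) * (1 + x\<^sup>2))"
  have q1: "q s y \<ge> 1 + y\<^sup>2" if "s \<ge> start" for s y
  proof -
    have "1 * (1 + y\<^sup>2) \<le> exp (2 * (s - start)) * (1 + y\<^sup>2)"
      using that by (intro mult_right_mono) auto
    then show ?thesis by (simp add: q_def)
  qed
  have qpos: "q t x > 0" by (auto simp: q_def add_pos_nonneg)
  \<comment> \<open>Half of what would cancel the negative value at the given point.\<close>
  define \<epsilon> where "\<epsilon> = - W t x / (2 * q t x)"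
  have eps: "\<epsilon> > 0" using neg qpos by (simp add: \<epsilon>_def divide_neg_pos)
  define V where "V = (\<lambda>t x. W t x + \<epsilon> * q t x)"
  have Vneg: "V t x < 0" using neg qpos by (simp add: V_def \<epsilon>_def field_simps)
  \<comment> \<open>Outside this radius the added term outweighs the lower bound of \<open>W\<close>.\<close>
  define R where "R = \<bar>x\<bar> + \<bar>B\<bar> / \<epsilon> + 1"
  have R1: "R \<ge> 1" "\<bar>x\<bar> \<le> R" "\<epsilon> * R \<ge> \<bar>B\<bar>" using eps by (auto simp: R_def algebra_simps)
  define E where "E = D \<inter> ({start..T} \<times> {-R..R})"
  have "compact E" unfolding E_def
    by (intro closed_Int_compact closed compact_Times compact_Icc)
  moreover have inE: "(t, x) \<in> E" using assms(6,7) time R1 by (auto simp: E_def)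
  moreover have "continuous_on E (\<lambda>(t, x). V t x)"
  proof -
    have "continuous_on E (\<lambda>(t, x). W t x)"
      using cont by (rule continuous_on_subset) (auto simp: E_def)
    then show ?thesis
      unfolding V_def q_def case_prod_unfold by (intro continuous_intros)
  qed
  ultimately obtain p where p: "p \<in> E" "\<And>p'. p' \<in> E \<Longrightarrow> (case p of (t, x) \<Rightarrow> V t x) \<le> (case p' of (t, x) \<Rightarrow> V t x)"
    using continuous_attains_inf[of E "\<lambda>(t, x). V t x"] by blast
  obtain s y where sy: "p = (s, y)" by fastforce
  have min: "V s y \<le> V s' y'" if "(s', y') \<in> E" for s' y' using p(2)[OF that] sy by simp
  have inD: "(s, y) \<in> D" "s \<le> T" "start \<le> s" using p sy by (auto simp: E_def)
  have Vsy: "V s y < 0" using min[OF inE] Vneg by simp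
  have "0 < \<epsilon> * q s y" using eps by (simp add: q_def add_pos_nonneg)
  then have Wsy: "W s y < 0" using Vsy unfolding V_def by linarith
  have yR: "\<bar>y\<bar> < R"
  proof (rule ccontr)
    assume "\<not> \<bar>y\<bar> < R"
    then have "R \<le> \<bar>y\<bar>" by simp
    then have "R * 1 \<le> \<bar>y\<bar> * \<bar>y\<bar>" using R1 by (intro mult_mono) auto
    then have "R \<le> q s y" using q1[OF inD(3), of y] by (simp add: power2_eq_square)
    then have "\<epsilon> * R \<le> \<epsilon> * q s y" using eps by simp
    then have "\<bar>B\<bar> \<le> \<epsilon> * q s y" using R1 by simp
    then show False using below[OF inD(1,2)] Vsy by (auto simp: V_def)
  qed
  obtain r where int: "(s, y) \<in> interior D" and r: "r \<ge> 0" "has_parabolic_value W s y r"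
    using super[OF inD(1,2) Wsy] by blast
  have hq: "has_parabolic_value (\<lambda>t x. \<epsilon> * q t x) s y (\<epsilon> * (exp (2 * (s - start)) * (1 + 3 * y\<^sup>2)))"
    unfolding has_parabolic_value_def q_def
    by (intro exI[of _ "\<epsilon> * (2 * exp (2 * (s - start)) * (1 + y\<^sup>2))"]
        exI[of _ "\<lambda>y. \<epsilon> * (exp (2 * (s - start)) * (2 * y))"] exI[of _ "\<epsilon> * (exp (2 * (s - start)) * 2)"])
       (auto intro!: derivative_eq_intros simp: algebra_simps)
  have "has_parabolic_value V s y (r + \<epsilon> * (exp (2 * (s - start)) * (1 + 3 * y\<^sup>2)))"
    unfolding V_def by (rule has_parabolic_value_add[OF r(2) hq])
  then obtain vt vx vxx where v:
    "((\<lambda>s. V s y) has_real_derivative vt) (at s)"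
    "\<And>y. (V s has_real_derivative vx y) (at y)"
    "(vx has_real_derivative vxx) (at y)"
    "r + \<epsilon> * (exp (2 * (s - start)) * (1 + 3 * y\<^sup>2)) = vt - vxx + V s y"
    unfolding has_parabolic_value_def by blast
  have "0 < \<epsilon> * (exp (2 * (s - start)) * (1 + 3 * y\<^sup>2))"
    using eps by (intro mult_pos_pos) (auto simp: add_pos_nonneg)
  then have "vt - vxx > 0" using v(4) Vsy r(1) by linarith
  obtain e where e: "e > 0" "ball (s, y) e \<subseteq> D" using int mem_interior by blast
  have "vxx \<ge> 0"
  proof (rule second_derivative_nonneg_at_min[OF v(2,3)])
    show "min e (R - \<bar>y\<bar>) > 0" using e yR by simp
    fix z assume z: "\<bar>z - y\<bar> < min e (R - \<bar>y\<bar>)"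
    then have "(s, z) \<in> ball (s, y) e" by (auto simp: dist_Pair_Pair dist_real_def)
    then show "V s y \<le> V s z" using e z inD by (intro min) (auto simp: E_def)
  qed
  moreover have "vt \<le> 0"
  proof (rule ccontr)
    assume "\<not> vt \<le> 0"
    then obtain d where d: "d > 0" "\<And>k. 0 < k \<Longrightarrow> k < d \<Longrightarrow> V (s - k) y < V s y"
      using DERIV_pos_inc_left[OF v(1)] by force
    define k where "k = min d e / 2"
    have k: "0 < k" "k < d" "k < e" using d e by (auto simp: k_def)
    then have "(s - k, y) \<in> ball (s, y) e" by (auto simp: dist_Pair_Pair dist_real_def)
    then have "(s - k, y) \<in> D" using e by auto
    then have "V s y \<le> V (s - k) y"
      using yR k inD time by (intro min) (auto simp: E_def)
    then show False using d(2)[of k] k by simp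
  qed
  ultimately show False using \<open>vt - vxx > 0\<close> by simp
qed

text \<open>
In the method of steps, when the sign at \<open>(t, x)\<close> is examined all signs up to time \<open>t - h\<close> are
known. A whole family is compared at once because a two-sided bound for a difference of solutions
is needed at earlier times even to obtain one of its two halves, \<open>g\<close> not being monotone.
\<close>

theorem comparison_principle:
  fixes W :: "'i \<Rightarrow> real \<Rightarrow> real \<Rightarrow> real"
  assumes "h > 0" and closed: "closed D"
    and time: "\<And>t x. (t, x) \<in> D \<Longrightarrow> start \<le> t"
    and cont: "\<And>i. continuous_on D (\<lambda>(t, x). W i t x)"
    and below: "\<And>i T. \<exists>B. \<forall>t x. (t, x) \<in> D \<longrightarrow> t \<le> T \<longrightarrow> B \<le> W i t x"
    and super: "\<And>i t x. (t, x) \<in> D \<Longrightarrow> W i t x < 0 \<Longrightarrow>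
        (\<And>j s y. (s, y) \<in> D \<Longrightarrow> s \<le> t - h \<Longrightarrow> 0 \<le> W j s y) \<Longrightarrow>
        (t, x) \<in> interior D \<and> (\<exists>r\<ge>0. has_parabolic_value (W i) t x r)"
    and "(t, x) \<in> D"
  shows "0 \<le> W i t x"
proof -
  \<comment> \<open>The shift by one makes the case \<open>n = 0\<close> vacuous.\<close>
  have *: "\<forall>i t x. (t, x) \<in> D \<longrightarrow> t \<le> start + (real n - 1) * h \<longrightarrow> 0 \<le> W i t x" for n
  proof (induction n)
    case 0
    show ?case using time \<open>h > 0\<close> by fastforce
  next
    case (Suc n)
    have "0 \<le> W i t x" if tx: "(t, x) \<in> D" "t \<le> start + real n * h" for i t x
    proof -
      obtain B where B: "\<And>t x. (t, x) \<in> D \<Longrightarrow> t \<le> start + real n * h \<Longrightarrow> B \<le> W i t x"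
        using below by blast
      show ?thesis
      proof (rule comparison_principle_finite_time[OF closed time cont B _ tx])
        fix t x assume a: "(t, x) \<in> D" "t \<le> start + real n * h" "W i t x < 0"
        show "(t, x) \<in> interior D \<and> (\<exists>r\<ge>0. has_parabolic_value (W i) t x r)"
        proof (rule super[OF a(1,3)])
          fix j s y assume "(s, y) \<in> D" "s \<le> t - h"
          with a(2) show "0 \<le> W j s y" by (intro Suc[rule_format]) (auto simp: algebra_simps)
        qed
      qed
    qed
    then show ?case by auto
  qed
  obtain n :: nat where "(t - start) / h + 1 \<le> real n" using real_arch_simple by blast
  then have "t \<le> start + (real n - 1) * h" using \<open>h > 0\<close> by (simp add: field_simps)
  then show ?thesis using * assms(7) by blast
qed

corollary comparison_principle_single:
  fixes W :: "real \<Rightarrow> real \<Rightarrow> real"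
  assumes "h > 0" "closed D"
    and "\<And>t x. (t, x) \<in> D \<Longrightarrow> start \<le> t"
    and "continuous_on D (\<lambda>(t, x). W t x)"
    and "\<And>T. \<exists>B. \<forall>t x. (t, x) \<in> D \<longrightarrow> t \<le> T \<longrightarrow> B \<le> W t x"
    and super: "\<And>t x. (t, x) \<in> D \<Longrightarrow> W t x < 0 \<Longrightarrow>
        (\<And>s y. (s, y) \<in> D \<Longrightarrow> s \<le> t - h \<Longrightarrow> 0 \<le> W s y) \<Longrightarrow>
        (t, x) \<in> interior D \<and> (\<exists>r\<ge>0. has_parabolic_value W t x r)"
    and "(t, x) \<in> D"
  shows "0 \<le> W t x"
proof (rule comparison_principle[where W = "\<lambda>_::unit. W", OF assms(1-5) _ assms(7)])
  fix i :: unit and t x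
  assume a: "(t, x) \<in> D" "W t x < 0"
    and earlier: "\<And>j::unit. \<And>s y. (s, y) \<in> D \<Longrightarrow> s \<le> t - h \<Longrightarrow> 0 \<le> W s y"
  show "(t, x) \<in> interior D \<and> (\<exists>r\<ge>0. has_parabolic_value W t x r)"
    by (rule super[OF a]) (rule earlier)
qed

corollary comparison_principle_abs:
  fixes w E :: "real \<Rightarrow> real \<Rightarrow> real"
  assumes h: "h > 0" and closed: "closed D"
    and time: "\<And>t x. (t, x) \<in> D \<Longrightarrow> start \<le> t"
    and cont: "continuous_on D (\<lambda>(t, x). w t x)" "continuous_on D (\<lambda>(t, x). E t x)"
    and bounded: "\<And>T. \<exists>B. \<forall>t x. (t, x) \<in> D \<longrightarrow> t \<le> T \<longrightarrow> \<bar>w t x\<bar> \<le> B"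
    and E: "\<And>t x. 0 \<le> E t x"
    and super: "\<And>t x. (t, x) \<in> D \<Longrightarrow> E t x < \<bar>w t x\<bar> \<Longrightarrow>
        (\<And>s y. (s, y) \<in> D \<Longrightarrow> s \<le> t - h \<Longrightarrow> \<bar>w s y\<bar> \<le> E s y) \<Longrightarrow>
        (t, x) \<in> interior D \<and> (\<exists>r s. has_parabolic_value w t x r \<and> has_parabolic_value E t x s \<and> \<bar>r\<bar> \<le> s)"
    and tx: "(t, x) \<in> D"
  shows "\<bar>w t x\<bar> \<le> E t x"
proof -
  define W where "W = (\<lambda>i::bool. \<lambda>t x. if i then E t x - w t x else E t x + w t x)"
  have "0 \<le> W i t x" for i
  proof (rule comparison_principle[where W = W, OF h closed time])
    show "continuous_on D (\<lambda>(t, x). W i t x)" for i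
      using cont unfolding W_def case_prod_unfold by (cases i) (auto intro!: continuous_intros)
    show "\<exists>B. \<forall>t x. (t, x) \<in> D \<longrightarrow> t \<le> T \<longrightarrow> B \<le> W i t x" for i T
    proof -
      obtain B where B: "\<And>t x. (t, x) \<in> D \<Longrightarrow> t \<le> T \<Longrightarrow> \<bar>w t x\<bar> \<le> B"
        using bounded by blast
      have "- B \<le> W i t x" if "(t, x) \<in> D" "t \<le> T" for t x
        using B[OF that] E[of t x] by (auto simp: W_def)
      then show ?thesis by blast
    qed
    fix i t x assume a: "(t, x) \<in> D" "W i t x < 0"
      and earlier: "\<And>j s y. (s, y) \<in> D \<Longrightarrow> s \<le> t - h \<Longrightarrow> 0 \<le> W j s y"
    have "E t x < \<bar>w t x\<bar>" using a(2) E[of t x] by (auto simp: W_def split: if_splits)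
    moreover have "\<bar>w s y\<bar> \<le> E s y" if "(s, y) \<in> D" "s \<le> t - h" for s y
      using earlier[OF that, of True] earlier[OF that, of False] by (auto simp: W_def)
    ultimately obtain r s where rs: "(t, x) \<in> interior D" "has_parabolic_value w t x r"
      "has_parabolic_value E t x s" "\<bar>r\<bar> \<le> s"
      using super[OF a(1)] by blast
    have "has_parabolic_value (W i) t x (if i then s - r else s + r)"
      using has_parabolic_value_diff[OF rs(3,2)] has_parabolic_value_add[OF rs(3,2)]
      by (cases i) (simp_all add: W_def)
    moreover have "0 \<le> (if i then s - r else s + r)" using rs(4) by auto
    ultimately show "(t, x) \<in> interior D \<and> (\<exists>r\<ge>0. has_parabolic_value (W i) t x r)"
      using rs(1) by blast
  qed (use tx in auto)
  from this[of True] this[of False] show ?thesis by (simp add: W_def)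
qed

definition moving_half_plane :: "real \<Rightarrow> real \<Rightarrow> real \<Rightarrow> (real \<times> real) set" where
  "moving_half_plane \<sigma> t0 z0 = {(t, x). t0 \<le> t \<and> z0 \<le> x + \<sigma> * t}"

lemma closed_moving_half_plane: "closed (moving_half_plane \<sigma> t0 z0)"
proof -
  have "moving_half_plane \<sigma> t0 z0 = {p. t0 \<le> fst p} \<inter> {p. z0 \<le> snd p + \<sigma> * fst p}"
    by (auto simp: moving_half_plane_def)
  moreover have "closed {p :: real \<times> real. t0 \<le> fst p}" "closed {p. z0 \<le> snd p + \<sigma> * fst p}"
    by (intro closed_Collect_le continuous_intros)+
  ultimately show ?thesis by (metis closed_Int)
qed

lemma interior_moving_half_plane:
  assumes "t0 < t" "z0 < x + \<sigma> * t"
  shows "(t, x) \<in> interior (moving_half_plane \<sigma> t0 z0)"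
proof -
  have "open ({p :: real \<times> real. t0 < fst p} \<inter> {p. z0 < snd p + \<sigma> * fst p})"
    by (intro open_Int open_Collect_less continuous_intros)
  then show ?thesis
    by (rule interiorI) (use assms in \<open>auto simp: moving_half_plane_def\<close>)
qed

lemma interior_time_domain: "t0 < t \<Longrightarrow> (t, x) \<in> interior ({t0::real..} \<times> (UNIV :: real set))"
proof -
  assume "t0 < t"
  have "open ({t0<..} \<times> (UNIV :: real set))" by (intro open_Times) auto
  then show ?thesis by (rule interiorI) (use \<open>t0 < t\<close> in auto)
qed

section \<open>The characteristic function\<close>

text \<open>
This strong form of convexity comes from \<open>1 + y \<le> exp y\<close>; it replaces all further discussion of
the shape of the characteristic function.
\<close>

lemma chi0_tangent:
  fixes x y :: real
  assumes "deriv g 0 > 0"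
  shows "chi0 h g c y \<ge> chi0 h g c x
     + (2 * x - c - c * h * deriv g 0 * exp (- x * c * h)) * (y - x) + (y - x)\<^sup>2"
proof -
  define p where "p = deriv g 0"
  define E where "E = exp (- x * c * h)"
  have "exp (- y * c * h) = E * exp (- ((y - x) * (c * h)))"
    by (simp add: E_def exp_add[symmetric] algebra_simps)
  moreover have "E * (1 + - ((y - x) * (c * h))) \<le> E * exp (- ((y - x) * (c * h)))"
    by (intro mult_left_mono exp_ge_add_one_self) (simp add: E_def)
  ultimately have "E * (1 - (y - x) * (c * h)) \<le> exp (- y * c * h)" by simp
  then have "p * (E * (1 - (y - x) * (c * h))) \<le> p * exp (- y * c * h)"
    using assms by (intro mult_left_mono) (auto simp: p_def)
  then show ?thesis
    unfolding chi0_def p_def[symmetric] E_def[symmetric]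
    by (simp add: algebra_simps power2_eq_square)
qed

lemma chi0_neg_between:
  assumes p: "deriv g 0 > 0" and "x < y" "y < z" "chi0 h g c x \<le> 0" "chi0 h g c z \<le> 0"
  shows "chi0 h g c y < 0"
proof -
  define s where "s = 2 * y - c - c * h * deriv g 0 * exp (- y * c * h)"
  have x: "chi0 h g c x \<ge> chi0 h g c y + s * (x - y) + (x - y)\<^sup>2"
    and z: "chi0 h g c z \<ge> chi0 h g c y + s * (z - y) + (z - y)\<^sup>2"
    using chi0_tangent[OF p] by (auto simp: s_def)
  have sq: "(x - y)\<^sup>2 > 0" "(z - y)\<^sup>2 > 0" using assms by auto
  show ?thesis
  proof (cases "s \<ge> 0")
    case True
    then have "s * (z - y) \<ge> 0" using assms by simp
    then show ?thesis using z sq assms by linarith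
  next
    case False
    then have "s * (x - y) \<ge> 0" using assms by (intro mult_nonpos_nonpos) auto
    then show ?thesis using x sq assms by linarith
  qed
qed

lemma chi0_strict_decreasing_speed:
  assumes "deriv g 0 > 0" "h \<ge> 0" "lam > 0" "c < c'"
  shows "chi0 h g c' lam < chi0 h g c lam"
proof -
  have "lam * (c * h) \<le> lam * (c' * h)"
    using assms by (intro mult_left_mono mult_right_mono) auto
  then have "exp (- lam * c' * h) \<le> exp (- lam * c * h)" by (simp add: mult.assoc)
  then have "deriv g 0 * exp (- lam * c' * h) \<le> deriv g 0 * exp (- lam * c * h)"
    using assms by simp
  moreover have "c * lam < c' * lam" using assms by simp
  ultimately show ?thesis unfolding chi0_def by linarith
qed

lemma chi0_pos_of_nonpos_speed:
  assumes "deriv g 0 > 1" "h \<ge> 0" "lam > 0" "c \<le> 0"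
  shows "chi0 h g c lam > 0"
proof -
  have "lam * c * h \<le> 0" using assms by (simp add: mult_nonneg_nonpos mult_nonpos_nonneg)
  then have "1 * 1 < deriv g 0 * exp (- lam * c * h)"
    using assms by (intro mult_less_le_imp_less) auto
  moreover have "c * lam \<le> 0" using assms by (simp add: mult_nonpos_nonneg)
  moreover have "lam\<^sup>2 \<ge> 0" by simp
  ultimately show ?thesis unfolding chi0_def by linarith
qed

lemma DERIV_chi0:
  "(chi0 h g c has_real_derivative 2 * x - c - c * h * deriv g 0 * exp (- x * c * h)) (at x)"
  unfolding chi0_def[abs_def]
  by (auto intro!: derivative_eq_intros)

lemma deriv_chi0:
  "deriv (chi0 h g c) = (\<lambda>x. 2 * x - c - c * h * deriv g 0 * exp (- x * c * h))"
  by (rule ext) (rule DERIV_imp_deriv[OF DERIV_chi0])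

lemma deriv2_chi0:
  "deriv (deriv (chi0 h g c)) x = 2 + (c * h)\<^sup>2 * deriv g 0 * exp (- x * c * h)"
  unfolding deriv_chi0
  by (rule DERIV_imp_deriv) (auto intro!: derivative_eq_intros simp: power2_eq_square)

lemma continuous_chi0: "isCont (chi0 h g c) x"
  using DERIV_chi0 by (rule DERIV_isCont)

text \<open>
The critical speed is the smallest \<open>c\<close> for which \<open>chi0\<close> takes a nonpositive value at some positive
argument \<open>l\<close>. The pairs \<open>(c, l)\<close> in question form a compact set once \<open>c\<close> is bounded. If \<open>chi0\<close>
were negative somewhere at the minimal speed, the speed could be decreased; so the minimal pair is
a zero at which \<open>chi0\<close> is minimal, hence a double zero.
\<close>

lemma chi0_critical_pair:
  assumes p: "deriv g 0 > 1" and h: "h > 0"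
  shows "\<exists>c>0. \<exists>lam>0. double_zero (chi0 h g c) lam"
proof -
  define q where "q = deriv g 0"
  have q: "q > 1" using p by (simp add: q_def)
  define F where "F = (\<lambda>(c, l). chi0 h g c l)"
  \<comment> \<open>At the speed \<open>q + 1\<close> the value at \<open>1\<close> is negative; and for speeds up to \<open>q + 1\<close>,
    nonpositive values occur only at arguments below \<open>q + 2\<close>.\<close>
  define E where "E = {0..q + 1} \<times> {0..q + 2} \<inter> {z. F z \<le> 0}"
  have contF: "continuous_on UNIV F"
    unfolding F_def chi0_def case_prod_unfold by (intro continuous_intros)
  have "closed {z. F z \<le> 0}"
    using contF by (intro closed_Collect_le) auto
  then have "compact E" unfolding E_def
    by (intro compact_Int_closed compact_Times compact_Icc)
  moreover have "(q + 1, 1) \<in> E"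
  proof -
    have "q * exp (- 1 * (q + 1) * h) \<le> q * 1" using q h by (intro mult_left_mono) (auto intro!: mult_nonpos_nonneg)
    then have "chi0 h g (q + 1) 1 \<le> 0" by (simp add: chi0_def q_def[symmetric])
    then show ?thesis using q by (simp add: E_def F_def)
  qed
  ultimately obtain z where z: "z \<in> E" "\<And>z'. z' \<in> E \<Longrightarrow> fst z \<le> fst z'"
    using continuous_attains_inf[of E fst] continuous_on_fst[OF continuous_on_id] by blast
  obtain c l where cl: "z = (c, l)" by fastforce
  have cle: "0 \<le> c" "c \<le> q + 1" "0 \<le> l" "chi0 h g c l \<le> 0" using z(1) cl by (auto simp: E_def F_def)
  have "l \<noteq> 0" using cle p by (auto simp: chi0_def)
  then have l: "l > 0" using cle by simp
  have c: "c > 0" using chi0_pos_of_nonpos_speed[OF p less_imp_le[OF h] l, of c] cle by linarith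
  have nonneg: "chi0 h g c x \<ge> 0" if "x > 0" for x
  proof (rule ccontr)
    assume neg: "\<not> ?thesis"
    have "continuous_on UNIV (\<lambda>c. chi0 h g c x)" unfolding chi0_def by (intro continuous_intros)
    then have "isCont (\<lambda>c. chi0 h g c x) c" by (simp add: continuous_on_eq_continuous_at)
    then have "((\<lambda>c. chi0 h g c x) \<longlongrightarrow> chi0 h g c x) (at_left c)"
      unfolding isCont_def by (rule tendsto_within_subset) simp
    then have "eventually (\<lambda>c. chi0 h g c x < 0) (at_left c)"
      using neg by (intro order_tendstoD(2)[of _ "chi0 h g c x"]) auto
    moreover have "eventually (\<lambda>c'. c' \<in> {0<..<c}) (at_left c)" using c by (rule eventually_at_left_real)
    ultimately have "eventually (\<lambda>c'. chi0 h g c' x < 0 \<and> c' \<in> {0<..<c}) (at_left c)"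
      by (rule eventually_conj)
    then obtain c' where c': "chi0 h g c' x < 0" "0 < c'" "c' < c"
      by (auto dest!: eventually_happens)
    have "x < q + 2"
    proof (rule ccontr)
      assume "\<not> x < q + 2"
      then have "x - c' \<ge> 1" "x \<ge> 1" using c' cle q by auto
      then have "x * (x - c') \<ge> 1 * 1" by (intro mult_mono) auto
      moreover have "q * exp (- x * c' * h) > 0" using q by simp
      ultimately show False using c' by (simp add: chi0_def q_def[symmetric] algebra_simps power2_eq_square)
    qed
    then have "(c', x) \<in> E" using c' cle that by (auto simp: E_def F_def)
    then show False using z(2) c' cl by fastforce
  qed
  have "2 * l - c - c * h * deriv g 0 * exp (- l * c * h) = 0"
  proof (rule DERIV_local_min[OF DERIV_chi0 l])
    show "\<forall>y. \<bar>l - y\<bar> < l \<longrightarrow> chi0 h g c l \<le> chi0 h g c y"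
      using nonneg cle(4) by (force intro: order_trans)
  qed
  moreover have "chi0 h g c l = 0" using nonneg[OF l] cle by simp
  moreover have "2 + (c * h)\<^sup>2 * deriv g 0 * exp (- l * c * h) > 0"
    using p by (simp add: add_pos_nonneg)
  ultimately have "double_zero (chi0 h g c) l"
    unfolding double_zero_def deriv2_chi0 by (simp add: deriv_chi0)
  then show ?thesis using c l by blast
qed

lemma chi0_nonneg_of_double_zero:
  assumes "deriv g 0 > 0" "double_zero (chi0 h g c) l"
  shows "chi0 h g c x \<ge> 0"
proof -
  have "chi0 h g c l = 0" "2 * l - c - c * h * deriv g 0 * exp (- l * c * h) = 0"
    using assms(2) unfolding double_zero_def deriv_chi0 by auto
  then have "chi0 h g c x \<ge> (x - l)\<^sup>2"
    using chi0_tangent[OF assms(1), of h c l x] by simp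
  then show ?thesis by (rule order_trans[rotated]) simp
qed

text \<open>
Two speeds with a double zero cannot differ: at the zero for the smaller speed, the function
for the larger one is negative by monotonicity in \<open>c\<close>, yet nonnegative by convexity.
\<close>

lemma c_sharp_critical:
  assumes p: "deriv g 0 > 1" and h: "h > 0"
  shows "c_sharp h g > 0 \<and> (\<exists>lam>0. chi0 h g (c_sharp h g) lam = 0)"
proof -
  obtain c l where c: "c > 0" "l > 0" "double_zero (chi0 h g c) l"
    using chi0_critical_pair[OF p h] by blast
  have no: False if "l > 0" "double_zero (chi0 h g c) l" "double_zero (chi0 h g c') l'" "c < c'"
    for c c' l l'
    using chi0_strict_decreasing_speed[of g h l c c'] chi0_nonneg_of_double_zero[of g h c' l' l]
      that p h unfolding double_zero_def by force
  have "c_sharp h g = c" unfolding c_sharp_def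
  proof (rule the_equality)
    show "\<exists>lam>0. double_zero (chi0 h g c) lam" using c by blast
    show "c' = c" if "\<exists>lam>0. double_zero (chi0 h g c') lam" for c'
      using no c that by (metis linorder_neqE_linordered_idom)
  qed
  then show ?thesis using c unfolding double_zero_def by auto
qed

lemma chi0_neg_between_roots:
  assumes p: "deriv g 0 > 1" and h: "h > 0" and c: "c > c_sharp h g"
    and lam: "lam \<in> {lambda1 h g c<..<lambda2 h g c}"
  shows "c > 0" "lam > 0" "chi0 h g c lam < 0"
proof -
  have cs: "c_sharp h g > 0"
    by (rule conjunct1[OF c_sharp_critical[OF p h]])
  obtain l where l: "l > 0" "chi0 h g (c_sharp h g) l = 0"
    using conjunct2[OF c_sharp_critical[OF p h]] by blast
  show "c > 0" using cs c by simp
  have neg: "chi0 h g c l < 0"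
    using chi0_strict_decreasing_speed[of g h l "c_sharp h g" c] l p h c by simp
  have cont: "continuous_on S (chi0 h g c)" for S
    by (simp add: continuous_at_imp_continuous_on continuous_chi0)
  have "chi0 h g c 0 > 0" using p by (simp add: chi0_def)
  then obtain a where a: "0 \<le> a" "a \<le> l" "chi0 h g c a = 0"
    using IVT2'[of "chi0 h g c" l 0 0] neg l cont by auto
  have "a \<noteq> 0" "a \<noteq> l" using a neg \<open>chi0 h g c 0 > 0\<close> by auto
  \<comment> \<open>Large enough for \<open>L * (L - c) \<ge> 1\<close>.\<close>
  define L where "L = l + c + 1"
  have "0 < chi0 h g c L"
  proof -
    have "L * (L - c) \<ge> 1 * 1" using l \<open>c > 0\<close> by (intro mult_mono) (auto simp: L_def)
    moreover have "deriv g 0 * exp (- L * c * h) > 0" using p by simp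
    ultimately show ?thesis by (simp add: chi0_def algebra_simps power2_eq_square)
  qed
  then obtain b where b: "l \<le> b" "b \<le> L" "chi0 h g c b = 0"
    using IVT'[of "chi0 h g c" l 0 L] neg l \<open>c > 0\<close> cont by (auto simp: L_def)
  have "b \<noteq> l" using b neg by auto
  have ab: "0 < a" "a < b" using a b \<open>a \<noteq> 0\<close> \<open>a \<noteq> l\<close> by auto
  have p0: "deriv g 0 > 0" using p by simp
  have "{x. chi0 h g c x = 0} = {a, b}"
  proof (intro set_eqI iffI)
    fix x assume "x \<in> {x. chi0 h g c x = 0}"
    then have x: "chi0 h g c x = 0" by simp
    show "x \<in> {a, b}"
    proof (rule ccontr)
      assume "x \<notin> {a, b}"
      then consider "x < a" | "a < x" "x < b" | "b < x" by force
      then show False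
        using chi0_neg_between[OF p0, of x a b h c] chi0_neg_between[OF p0, of a x b h c]
          chi0_neg_between[OF p0, of a b x h c] x a b ab by cases auto
    qed
  qed (use a b in auto)
  then have "lambda1 h g c = a" "lambda2 h g c = b"
    using ab by (auto simp: lambda1_def lambda2_def)
  then have "a < lam" "lam < b" using lam by auto
  then show "lam > 0" "chi0 h g c lam < 0"
    using ab chi0_neg_between[OF p0, of a lam b h c] a b by auto
qed

section \<open>The unimodal nonlinearity\<close>

text \<open>
On \<open>[a, xm]\<close>, and likewise on \<open>[xm, b]\<close>, a minimum cannot lie in the interior. Nor can it lie at \<open>xm\<close>: there \<open>g\<close> has a local
maximum, so \<open>g\<close> would be constant on a one-sided neighbourhood, all points of which would be local
extrema. So the minimum is attained at the outer endpoint only, which is strict monotonicity.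
\<close>

lemma no_local_extremum_imp_monotone:
  fixes g :: "real \<Rightarrow> real"
  assumes cont: "continuous_on UNIV g" and uni: "unimodal_at g xm"
  shows "a < b \<Longrightarrow> b \<le> xm \<Longrightarrow> g a < g b"
    and "xm \<le> a \<Longrightarrow> a < b \<Longrightarrow> g b < g a"
proof -
  have max: "\<forall>\<^sub>F y in at xm. g y \<le> g xm"
    and no_min: "\<And>x. (\<forall>\<^sub>F y in at x. g x \<le> g y) \<Longrightarrow> x = xm"
    and no_max: "\<And>x. (\<forall>\<^sub>F y in at x. g y \<le> g x) \<Longrightarrow> x = xm"
    using uni by (auto simp: unimodal_at_def local_max_def local_min_def)
  have interior_min: "x = xm" if "p < x" "x < q" "\<And>y. p \<le> y \<Longrightarrow> y \<le> q \<Longrightarrow> g x \<le> g y" for x p q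
  proof (rule no_min)
    have "\<forall>\<^sub>F y in at x. y \<in> {p<..<q}"
      using that by (intro eventually_at_in_open') auto
    then show "\<forall>\<^sub>F y in at x. g x \<le> g y" by eventually_elim (use that(3) in auto)
  qed
  obtain e where e: "e > 0" "\<And>y. \<bar>y - xm\<bar> < e \<Longrightarrow> g y \<le> g xm"
    using max by (force simp: eventually_at dist_real_def)
  have not_min: False if "p < q" "xm \<in> {p, q}" "\<And>y. p \<le> y \<Longrightarrow> y \<le> q \<Longrightarrow> g xm \<le> g y" for p q
  proof -
    define p' where "p' = max p (xm - e)"
    define q' where "q' = min q (xm + e)"
    have pq: "p' < q'" using that(1,2) e by (auto simp: p'_def q'_def)
    \<comment> \<open>Near \<open>xm\<close> and inside \<open>[p, q]\<close>, the value at \<open>xm\<close> is both a maximum and a minimum.\<close>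
    have const: "g y = g xm" if "p' < y" "y < q'" for y
      using that \<open>\<And>y. p \<le> y \<Longrightarrow> y \<le> q \<Longrightarrow> g xm \<le> g y\<close>[of y] e(2)[of y]
      by (fastforce simp: p'_def q'_def)
    define z where "z = (p' + q') / 2"
    have z: "p' < z" "z < q'" using pq by (auto simp: z_def)
    have "\<forall>\<^sub>F y in at z. y \<in> {p'<..<q'}"
      using z by (intro eventually_at_in_open') auto
    then have "\<forall>\<^sub>F y in at z. g z \<le> g y" by eventually_elim (use const z in auto)
    then have "z = xm" by (rule no_min)
    then show False using z that(2) by (auto simp: p'_def q'_def)
  qed
  show "g a < g b" if "a < b" "b \<le> xm"
  proof -
    have "\<exists>x\<in>{a..xm}. \<forall>y\<in>{a..xm}. g x \<le> g y"
      using that by (intro continuous_attains_inf continuous_on_subset[OF cont]) auto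
    then obtain x where x: "x \<in> {a..xm}" "\<And>y. y \<in> {a..xm} \<Longrightarrow> g x \<le> g y" by blast
    have only: "y = a" if "y \<in> {a..xm}" "\<And>z. z \<in> {a..xm} \<Longrightarrow> g y \<le> g z" for y
    proof (rule ccontr)
      assume "y \<noteq> a"
      then have "y = xm" using interior_min[of a y xm] that by (cases "y = xm") auto
      then show False using not_min[of a xm] that \<open>a < b\<close> \<open>b \<le> xm\<close> by auto
    qed
    have "x = a" using only x by blast
    show ?thesis
    proof (rule ccontr)
      assume "\<not> g a < g b"
      then have "b = a" using x \<open>x = a\<close> that by (intro only) (auto intro: order_trans[of _ "g a"])
      then show False using that by simp
    qed
  qed
  show "g b < g a" if "xm \<le> a" "a < b"
  proof -
    have "\<exists>x\<in>{xm..b}. \<forall>y\<in>{xm..b}. g x \<le> g y"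
      using that by (intro continuous_attains_inf continuous_on_subset[OF cont]) auto
    then obtain x where x: "x \<in> {xm..b}" "\<And>y. y \<in> {xm..b} \<Longrightarrow> g x \<le> g y" by blast
    have only: "y = b" if "y \<in> {xm..b}" "\<And>z. z \<in> {xm..b} \<Longrightarrow> g y \<le> g z" for y
    proof (rule ccontr)
      assume "y \<noteq> b"
      then have "y = xm" using interior_min[of xm y b] that by (cases "y = xm") auto
      then show False using not_min[of xm b] that \<open>xm \<le> a\<close> \<open>a < b\<close> by auto
    qed
    have "x = b" using only x by blast
    show ?thesis
    proof (rule ccontr)
      assume "\<not> g b < g a"
      then have "a = b" using x \<open>x = b\<close> that by (intro only) (auto intro: order_trans[of _ "g b"])
      then show False using that by simp
    qed
  qed
qed

locale unimodal_birth =
  fixes \<kappa> xm :: real and g :: "real \<Rightarrow> real"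
  assumes UM: "hyp_UM \<kappa> g" and xm: "xm \<in> {0<..<\<kappa>}" and unimodal: "unimodal_at g xm"
    and slope: "\<forall>x\<in>{g (g xm)..g xm}. g field_differentiable (at x) \<and> \<bar>deriv g x\<bar> < 1"
begin

lemma shows cont_nonneg: "continuous_on {0..} g"
    and g_nonneg: "\<And>x. 0 \<le> x \<Longrightarrow> 0 \<le> g x"
    and g_neg: "\<And>x. x \<le> 0 \<Longrightarrow> g x = deriv g 0 * x"
    and fixpoints: "{x. x \<ge> 0 \<and> g x = x} = {0, \<kappa>}"
    and slope0: "deriv g 0 > 1"
    and lipschitz: "\<And>u v. 0 \<le> u \<Longrightarrow> 0 \<le> v \<Longrightarrow> \<bar>g u - g v\<bar> \<le> deriv g 0 * \<bar>u - v\<bar>"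
    and C1: "\<exists>\<delta>>0. (\<forall>x \<in> cball 0 \<delta> \<union> cball \<kappa> \<delta>. g field_differentiable (at x)) \<and>
        continuous_on (cball 0 \<delta> \<union> cball \<kappa> \<delta>) (deriv g)"
    and g_bounded: "\<exists>B. \<forall>x\<ge>0. g x \<le> B"
proof -
  have "hyp_H \<kappa> (deriv g 0) g" "bounded (g ` {0..})" using UM by (auto simp: hyp_UM_def)
  then show "continuous_on {0..} g" "\<And>x. 0 \<le> x \<Longrightarrow> 0 \<le> g x"
    "\<And>x. x \<le> 0 \<Longrightarrow> g x = deriv g 0 * x" "{x. x \<ge> 0 \<and> g x = x} = {0, \<kappa>}"
    "deriv g 0 > 1"
    "\<And>u v. 0 \<le> u \<Longrightarrow> 0 \<le> v \<Longrightarrow> \<bar>g u - g v\<bar> \<le> deriv g 0 * \<bar>u - v\<bar>"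
    "\<exists>\<delta>>0. (\<forall>x \<in> cball 0 \<delta> \<union> cball \<kappa> \<delta>. g field_differentiable (at x)) \<and>
        continuous_on (cball 0 \<delta> \<union> cball \<kappa> \<delta>) (deriv g)"
    unfolding hyp_H_def by blast+
  show "\<exists>B. \<forall>x\<ge>0. g x \<le> B"
    using \<open>bounded (g ` {0..})\<close> unfolding bounded_iff by (auto intro: abs_le_D1)
qed

lemma g_0: "g 0 = 0" and g_kappa: "g \<kappa> = \<kappa>"
  using fixpoints by (blast, blast)

lemma fixpoint_cases: "0 \<le> x \<Longrightarrow> g x = x \<Longrightarrow> x = 0 \<or> x = \<kappa>"
  using fixpoints by blast

lemma cont: "continuous_on UNIV g"
proof -
  have "continuous_on {..0} g"
    by (rule continuous_on_eq[of _ "\<lambda>x. deriv g 0 * x"]) (auto intro!: continuous_intros simp: g_neg)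
  then have "continuous_on ({..0} \<union> {0..}) g"
    using cont_nonneg by (intro continuous_on_closed_Un) auto
  moreover have "{..0} \<union> {0..} = (UNIV :: real set)" by auto
  ultimately show ?thesis by simp
qed

lemma increasing: "a < b \<Longrightarrow> b \<le> xm \<Longrightarrow> g a < g b"
  and decreasing: "xm \<le> a \<Longrightarrow> a < b \<Longrightarrow> g b < g a"
  using no_local_extremum_imp_monotone[OF cont unimodal] by auto

lemma g_le_max: "g x \<le> g xm"
  using increasing[of x xm] decreasing[of xm x] by (cases x xm rule: linorder_cases) auto

lemma antimono: "xm \<le> a \<Longrightarrow> a \<le> b \<Longrightarrow> g b \<le> g a"
  using decreasing[of a b] by (cases "a = b") auto

lemma g_pos: "0 < x \<Longrightarrow> 0 < g x"
proof (cases "x \<le> xm")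
  case True
  then show "0 < x \<Longrightarrow> 0 < g x" using increasing[of 0 x] g_0 by simp
next
  case False
  then show "0 < x \<Longrightarrow> 0 < g x" using decreasing[of x "x + 1"] g_nonneg[of "x + 1"] by force
qed

lemma g_above_diagonal: "0 < x \<Longrightarrow> x < \<kappa> \<Longrightarrow> x < g x"
proof -
  assume x: "0 < x" "x < \<kappa>"
  have "g field_differentiable (at 0)" using C1 by auto
  then have "(g has_real_derivative deriv g 0) (at 0)"
    by (simp add: DERIV_deriv_iff_field_differentiable)
  then have "((\<lambda>x. g x - x) has_real_derivative deriv g 0 - 1) (at 0)"
    by (auto intro!: derivative_eq_intros)
  from DERIV_pos_inc_right[OF this] slope0 obtain d where
    d: "d > 0" "\<And>k. 0 < k \<Longrightarrow> k < d \<Longrightarrow> 0 < g k - k" using g_0 by auto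
  define k where "k = min d x / 2"
  have k: "0 < k" "k < d" "k < x" using d x by (auto simp: k_def)
  show "x < g x"
  proof (rule ccontr)
    assume "\<not> x < g x"
    then have "\<exists>z\<ge>k. z \<le> x \<and> g z - z = 0"
      using d(2)[of k] k
      by (intro IVT2') (auto intro!: continuous_intros continuous_on_subset[OF cont])
    then obtain z where "k \<le> z" "z \<le> x" "g z = z" by auto
    then have "z = 0 \<or> z = \<kappa>" using fixpoint_cases[of z] k by auto
    then show False using k x \<open>k \<le> z\<close> \<open>z \<le> x\<close> by auto
  qed
qed

lemma kappa_in_core: "g (g xm) \<le> \<kappa>" "\<kappa> \<le> g xm"
  using g_le_max[of \<kappa>] antimono[of \<kappa> "g xm"] g_kappa xm by auto

text \<open>
The slopes in the core interval need not be bounded away from one, so no contraction constant is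
available here; it exists only near \<open>\<kappa>\<close>, where \<open>g\<close> is \<open>C\<^sup>1\<close> (see \<open>contraction_near_kappa\<close>).
\<close>

lemma strict_contraction:
  assumes "x \<in> {g (g xm)..g xm}" "y \<in> {g (g xm)..g xm}" "x \<noteq> y"
  shows "\<bar>g x - g y\<bar> < \<bar>x - y\<bar>"
proof -
  have *: "\<bar>g b - g a\<bar> < b - a" if "a < b" "g (g xm) \<le> a" "b \<le> g xm" for a b
  proof -
    have D: "(g has_real_derivative deriv g z) (at z)" "\<bar>deriv g z\<bar> < 1" if "a \<le> z" "z \<le> b" for z
      using slope that \<open>g (g xm) \<le> a\<close> \<open>b \<le> g xm\<close>
      by (auto simp: DERIV_deriv_iff_field_differentiable)
    obtain z where z: "z > a" "z < b" "g b - g a = (b - a) * deriv g z"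
      using MVT2[OF \<open>a < b\<close> D(1)] by auto
    then show ?thesis using D(2)[of z] \<open>a < b\<close> by (simp add: abs_mult)
  qed
  show ?thesis
    using *[of x y] *[of y x] assms by (cases x y rule: linorder_cases) auto
qed

text \<open>
The point \<open>y'\<close> cannot lie left of \<open>\<kappa>\<close>, where \<open>g\<close> is above the diagonal. Hence \<open>g y'\<close> is a
value on the decreasing branch, at an argument not exceeding the maximal value of \<open>g\<close>, and
\<open>[m, M]\<close> lies in the core interval. There \<open>g\<close> strictly shortens distances, whereas the hypotheses
give \<open>M - m \<le> g y - g y'\<close>.
\<close>

lemma invariant_interval_trivial:
  assumes "0 < m" "m \<le> M" "y \<in> {m..M}" "M \<le> g y" "y' \<in> {m..M}" "g y' \<le> m"
  shows "m = \<kappa> \<and> M = \<kappa>"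
proof -
  have M: "M \<le> g xm" using assms(4) g_le_max[of y] by simp
  have "\<not> y' < \<kappa>" using g_above_diagonal[of y'] assms by auto
  then have "g (g xm) \<le> g y'" using antimono[of y' "g xm"] xm assms M by auto
  then have m: "g (g xm) \<le> m" using assms by simp
  have "M - m \<le> \<bar>g y - g y'\<bar>" using assms by auto
  moreover have "\<bar>y - y'\<bar> \<le> M - m" using assms by auto
  moreover have "y \<noteq> y' \<Longrightarrow> \<bar>g y - g y'\<bar> < \<bar>y - y'\<bar>"
    using assms m M by (intro strict_contraction) auto
  ultimately have "y = y'" by linarith
  then have "g y = y" "y = m" "M = m" using assms by auto
  then show ?thesis using fixpoint_cases[of y] assms by auto
qed

text \<open>
The value of \<open>g\<close> at a point of \<open>[a, B]\<close> is at least the point itself on the increasing branch, and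
at least the value at the right end on the decreasing one.
\<close>

lemma persistence_level:
  assumes "B > 0"
  shows "\<exists>a0>0. \<forall>a v. 0 < a \<longrightarrow> a \<le> a0 \<longrightarrow> a \<le> v \<longrightarrow> v \<le> B \<longrightarrow> a \<le> g v"
proof (intro exI conjI allI impI)
  show "0 < g (max B xm)" using assms by (intro g_pos) auto
  fix a v assume a: "0 < a" "a \<le> g (max B xm)" "a \<le> v" "v \<le> B"
  show "a \<le> g v"
  proof (cases "v \<le> xm")
    case True
    then show ?thesis using g_above_diagonal[of v] a xm by auto
  next
    case False
    then show ?thesis using antimono[of v "max B xm"] a by auto
  qed
qed

lemma contraction_near_kappa:
  "\<exists>r>0. \<exists>q<1. 0 \<le> q \<and> (\<forall>x y. \<bar>x - \<kappa>\<bar> \<le> r \<longrightarrow> \<bar>y - \<kappa>\<bar> \<le> r \<longrightarrow> \<bar>g x - g y\<bar> \<le> q * \<bar>x - y\<bar>)"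
proof -
  obtain \<delta> where \<delta>: "\<delta> > 0" "\<And>x. \<bar>x - \<kappa>\<bar> \<le> \<delta> \<Longrightarrow> g field_differentiable (at x)"
    "continuous_on (cball \<kappa> \<delta>) (deriv g)"
  proof -
    obtain \<delta> where \<delta>: "\<delta> > 0"
      "\<forall>x \<in> cball 0 \<delta> \<union> cball \<kappa> \<delta>. g field_differentiable (at x)"
      "continuous_on (cball 0 \<delta> \<union> cball \<kappa> \<delta>) (deriv g)"
      using C1 by blast
    have "continuous_on (cball \<kappa> \<delta>) (deriv g)" by (rule continuous_on_subset[OF \<delta>(3)]) simp
    then show ?thesis using \<delta> by (intro that[of \<delta>]) (simp_all add: dist_real_def abs_minus_commute)
  qed
  have "\<bar>deriv g \<kappa>\<bar> < 1" using slope kappa_in_core by auto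
  define q where "q = (1 + \<bar>deriv g \<kappa>\<bar>) / 2"
  have q: "\<bar>deriv g \<kappa>\<bar> < q" "q < 1" "0 \<le> q" using \<open>\<bar>deriv g \<kappa>\<bar> < 1\<close> by (auto simp: q_def)
  obtain d where d: "d > 0"
    "\<And>x. x \<in> cball \<kappa> \<delta> \<Longrightarrow> dist x \<kappa> < d \<Longrightarrow> dist (deriv g x) (deriv g \<kappa>) < q - \<bar>deriv g \<kappa>\<bar>"
  proof -
    have "\<kappa> \<in> cball \<kappa> \<delta>" "0 < q - \<bar>deriv g \<kappa>\<bar>" using \<delta>(1) q by auto
    then show ?thesis using \<delta>(3) that unfolding continuous_on_iff by blast
  qed
  define r where "r = min \<delta> (d / 2)"
  have r: "r > 0" "r \<le> \<delta>" "r < d" using \<delta> d by (auto simp: r_def)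
  have D: "norm (deriv g x) \<le> q" if "x \<in> cball \<kappa> r" for x
    using d(2)[of x] that r by (simp add: dist_real_def abs_minus_commute)
  have "\<bar>g x - g y\<bar> \<le> q * \<bar>x - y\<bar>" if "\<bar>x - \<kappa>\<bar> \<le> r" "\<bar>y - \<kappa>\<bar> \<le> r" for x y
  proof -
    have "norm (g x - g y) \<le> q * norm (x - y)"
    proof (rule field_differentiable_bound[of "cball \<kappa> r" g "deriv g"])
      fix z assume "z \<in> cball \<kappa> r"
      then have "g field_differentiable (at z)" using r by (intro \<delta>) (auto simp: dist_real_def)
      then show "(g has_field_derivative deriv g z) (at z within cball \<kappa> r)"
        by (meson DERIV_deriv_iff_field_differentiable has_field_derivative_at_within)
    qed (use D that in \<open>auto simp: dist_real_def\<close>)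
    then show ?thesis by simp
  qed
  then show ?thesis using r q by blast
qed

end

section \<open>Bounds for classical solutions\<close>

lemma classical_solution_parabolic:
  assumes "classical_solution h g u" "t > 0"
  shows "has_parabolic_value u t x (g (u (t - h) x))"
proof -
  obtain ut ux uxx where
    "((\<lambda>t. u t x) has_real_derivative ut t x) (at t)"
    "\<forall>x. ((\<lambda>x. u t x) has_real_derivative ux t x) (at x)"
    "((\<lambda>x. ux t x) has_real_derivative uxx t x) (at x)"
    "ut t x = uxx t x - u t x + g (u (t - h) x)"
    using assms unfolding classical_solution_def by blast
  then show ?thesis
    unfolding has_parabolic_value_def
    by (intro exI[of _ "ut t x"] exI[of _ "ux t"] exI[of _ "uxx t x"]) auto
qed

lemma classical_solution_continuous:
  "classical_solution h g u \<Longrightarrow> continuous_on ({-h..} \<times> UNIV) (\<lambda>(t, x). u t x)"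
  unfolding classical_solution_def by blast

lemma classical_solution_bounded:
  assumes "classical_solution h g u"
  obtains B where "B > 0" "\<And>t x. -h \<le> t \<Longrightarrow> t \<le> T \<Longrightarrow> \<bar>u t x\<bar> \<le> B"
proof -
  have "bounded ((\<lambda>(t, x). u t x) ` ({-h..T} \<times> UNIV))"
    using assms unfolding classical_solution_def by blast
  then obtain B where "B > 0" "\<forall>y\<in>(\<lambda>(t, x). u t x) ` ({-h..T} \<times> UNIV). norm y \<le> B"
    unfolding bounded_pos by blast
  then show ?thesis by (intro that[of B]) auto
qed

lemma bounded_on_finite_time:
  assumes "classical_solution h g u" "D \<subseteq> {-h..} \<times> UNIV"
  shows "\<exists>B. \<forall>t x. (t, x) \<in> D \<longrightarrow> t \<le> T \<longrightarrow> \<bar>u t x\<bar> \<le> B"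
proof -
  obtain B where "\<And>t x. -h \<le> t \<Longrightarrow> t \<le> T \<Longrightarrow> \<bar>u t x\<bar> \<le> B"
    using classical_solution_bounded[OF assms(1)] by blast
  then show ?thesis using assms(2) by (intro exI[of _ B]) auto
qed

lemma solution_nonneg:
  assumes h: "h > 0" and sol: "classical_solution h g u"
    and g: "\<And>y. 0 \<le> y \<Longrightarrow> 0 \<le> g y"
    and init: "\<And>s x. s \<in> {-h..0} \<Longrightarrow> 0 \<le> u s x"
    and t: "-h \<le> t"
  shows "0 \<le> u t x"
proof (rule comparison_principle_single[where D = "{-h..} \<times> UNIV" and h = h and start = "-h" and W = u])
  show "\<exists>B. \<forall>t x. (t, x) \<in> {-h..} \<times> UNIV \<longrightarrow> t \<le> T \<longrightarrow> B \<le> u t x" for T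
  proof -
    obtain B where "\<And>t x. -h \<le> t \<Longrightarrow> t \<le> T \<Longrightarrow> \<bar>u t x\<bar> \<le> B"
      using classical_solution_bounded[OF sol] by blast
    then show ?thesis by (intro exI[of _ "- B"]) (auto simp: abs_le_iff minus_le_iff)
  qed
  fix t x assume a: "(t, x) \<in> {-h..} \<times> (UNIV :: real set)" "u t x < 0"
    and earlier: "\<And>s y. (s, y) \<in> {-h..} \<times> (UNIV :: real set) \<Longrightarrow> s \<le> t - h \<Longrightarrow> 0 \<le> u s y"
  have "t > 0" using a init[of t x] by force
  then have "0 \<le> g (u (t - h) x)" using earlier[of "t - h" x] by (intro g) auto
  then show "(t, x) \<in> interior ({-h..} \<times> UNIV) \<and> (\<exists>r\<ge>0. has_parabolic_value u t x r)"
    using classical_solution_parabolic[OF sol \<open>t > 0\<close>] \<open>t > 0\<close> h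
    by (intro conjI interior_time_domain) auto
qed (use h t classical_solution_continuous[OF sol] in \<open>auto intro: closed_Times\<close>)

lemma solution_le:
  assumes h: "h > 0" and sol: "classical_solution h g u"
    and g: "\<And>y. 0 \<le> y \<Longrightarrow> g y \<le> B"
    and init: "\<And>s x. s \<in> {-h..0} \<Longrightarrow> u s x \<le> B"
    and nonneg: "\<And>t x. -h \<le> t \<Longrightarrow> 0 \<le> u t x"
    and t: "-h \<le> t"
  shows "u t x \<le> B"
proof -
  have "0 \<le> B - u t x"
  proof (rule comparison_principle_single[where D = "{-h..} \<times> UNIV" and h = h and start = "-h"
        and W = "\<lambda>t x. B - u t x"])
    show "\<exists>b. \<forall>t x. (t, x) \<in> {-h..} \<times> UNIV \<longrightarrow> t \<le> T \<longrightarrow> b \<le> B - u t x" for T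
    proof -
      obtain b where "\<And>t x. -h \<le> t \<Longrightarrow> t \<le> T \<Longrightarrow> \<bar>u t x\<bar> \<le> b"
        using classical_solution_bounded[OF sol] by blast
      then show ?thesis by (intro exI[of _ "B - b"]) (auto simp: abs_le_iff)
    qed
    show "continuous_on ({-h..} \<times> UNIV) (\<lambda>(t, x). B - u t x)"
      using classical_solution_continuous[OF sol] unfolding case_prod_unfold
      by (intro continuous_intros)
    fix t x assume a: "(t, x) \<in> {-h..} \<times> (UNIV :: real set)" "B - u t x < 0"
    have "t > 0" using a init[of t x] by force
    then have "g (u (t - h) x) \<le> B" using nonneg h by (intro g) auto
    then show "(t, x) \<in> interior ({-h..} \<times> UNIV) \<and> (\<exists>r\<ge>0. has_parabolic_value (\<lambda>t x. B - u t x) t x r)"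
      using has_parabolic_value_diff[OF has_parabolic_value_const
          classical_solution_parabolic[OF sol \<open>t > 0\<close>], of B x] \<open>t > 0\<close> h
      by (intro conjI interior_time_domain exI[of _ "B - g (u (t - h) x)"]) auto
  qed (use h t in \<open>auto intro: closed_Times\<close>)
  then show ?thesis by simp
qed

text \<open>
A common form of the two stability estimates: at the rear, \<open>q = g'(0)\<close> and \<open>a > 0\<close>; near \<open>\<kappa>\<close>,
\<open>q < 1\<close> and \<open>a = 0\<close>. The hypothesis \<open>rate\<close> says that the exponential is a supersolution of
\<open>v_t = v_xx - v + q * v(t - h)\<close>.
\<close>

lemma exponential_difference_bound:
  assumes h: "h > 0" and u: "classical_solution h g u" and p: "classical_solution h g p"
    and closed: "closed D" and D: "D \<subseteq> {-h..} \<times> UNIV"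
    and K: "0 \<le> K" and q: "0 \<le> q" and rate: "q * exp (- (b * h)) \<le> b - a\<^sup>2 + 1"
    and cases: "\<And>t x. (t, x) \<in> D \<Longrightarrow> \<bar>u t x - p t x\<bar> \<le> K * exp (a * x + b * t) \<or>
       0 < t \<and> (t, x) \<in> interior D \<and> (t - h, x) \<in> D \<and>
       \<bar>g (u (t - h) x) - g (p (t - h) x)\<bar> \<le> q * \<bar>u (t - h) x - p (t - h) x\<bar>"
    and tx: "(t, x) \<in> D"
  shows "\<bar>u t x - p t x\<bar> \<le> K * exp (a * x + b * t)"
proof (rule comparison_principle_abs[where D = D and h = h and start = "-h"
      and w = "\<lambda>t x. u t x - p t x" and E = "\<lambda>t x. K * exp (a * x + b * t)"])
  show "continuous_on D (\<lambda>(t, x). u t x - p t x)"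
    using continuous_on_subset[OF classical_solution_continuous[OF u] D]
      continuous_on_subset[OF classical_solution_continuous[OF p] D]
    unfolding case_prod_unfold by (intro continuous_intros)
  show "continuous_on D (\<lambda>(t, x). K * exp (a * x + b * t))"
    unfolding case_prod_unfold by (intro continuous_intros)
  show "\<exists>B. \<forall>t x. (t, x) \<in> D \<longrightarrow> t \<le> T \<longrightarrow> \<bar>u t x - p t x\<bar> \<le> B" for T
  proof -
    obtain B1 B2 where B: "\<And>t x. (t, x) \<in> D \<Longrightarrow> t \<le> T \<Longrightarrow> \<bar>u t x\<bar> \<le> B1"
        "\<And>t x. (t, x) \<in> D \<Longrightarrow> t \<le> T \<Longrightarrow> \<bar>p t x\<bar> \<le> B2"
      using bounded_on_finite_time[OF u D, of T] bounded_on_finite_time[OF p D, of T]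
      by blast
    have "\<bar>u t x - p t x\<bar> \<le> B1 + B2" if "(t, x) \<in> D" "t \<le> T" for t x
      using B[OF that] abs_triangle_ineq4[of "u t x" "p t x"] by linarith
    then show ?thesis by blast
  qed
  fix t x
  assume a: "(t, x) \<in> D" "K * exp (a * x + b * t) < \<bar>u t x - p t x\<bar>"
    and earlier: "\<And>s y. (s, y) \<in> D \<Longrightarrow> s \<le> t - h \<Longrightarrow> \<bar>u s y - p s y\<bar> \<le> K * exp (a * y + b * s)"
  have t: "0 < t" "(t, x) \<in> interior D" "(t - h, x) \<in> D"
    and g: "\<bar>g (u (t - h) x) - g (p (t - h) x)\<bar> \<le> q * \<bar>u (t - h) x - p (t - h) x\<bar>"
    using cases[OF a(1)] a(2) by auto
  note g
  also have "q * \<bar>u (t - h) x - p (t - h) x\<bar> \<le> q * (K * exp (a * x + b * (t - h)))"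
    using earlier[OF t(3)] q by (intro mult_left_mono) auto
  also have "\<dots> = q * exp (- (b * h)) * (K * exp (a * x + b * t))"
    by (simp add: exp_add[symmetric] algebra_simps)
  also have "\<dots> \<le> (b - a\<^sup>2 + 1) * (K * exp (a * x + b * t))"
    using rate K by (intro mult_right_mono) auto
  finally show "(t, x) \<in> interior D \<and> (\<exists>r s. has_parabolic_value (\<lambda>t x. u t x - p t x) t x r \<and>
      has_parabolic_value (\<lambda>t x. K * exp (a * x + b * t)) t x s \<and> \<bar>r\<bar> \<le> s)"
    using t(2) has_parabolic_value_exp
      has_parabolic_value_diff[OF classical_solution_parabolic[OF u t(1)] classical_solution_parabolic[OF p t(1)]]
    by blast
qed (use h closed D K tx in auto)

section \<open>Convergence to the equilibrium behind the front\<close>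

text \<open>
The source \<open>G\<close> is a stationary supersolution. The excess \<open>\<bar>C - G\<bar>\<close> of the initial values is
absorbed by a term decaying in time, and the excess of the lateral boundary values by one decaying
in \<open>x + c * t\<close>. The rate \<open>\<mu> = 1 / (c + 1)\<close> of the latter satisfies \<open>\<mu> * c + \<mu>\<^sup>2 \<le> 1\<close>, as is
needed for a supersolution.
\<close>

lemma upper_relaxation:
  assumes c: "c > 0"
    and cont: "continuous_on (moving_half_plane c t1 z1) (\<lambda>(t, x). v t x)"
    and bound: "\<And>t x. t1 \<le> t \<Longrightarrow> z1 \<le> x + c * t \<Longrightarrow> v t x \<le> C"
    and sub: "\<And>t x. t1 < t \<Longrightarrow> z1 < x + c * t \<Longrightarrow> \<exists>r\<le>G. has_parabolic_value v t x r"
    and tx: "t1 \<le> t" "z1 \<le> x + c * t"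
  shows "v t x \<le> G + \<bar>C - G\<bar> * (exp (t1 - t) + exp ((z1 - (x + c * t)) / (c + 1)))"
proof -
  define \<mu> where "\<mu> = 1 / (c + 1)"
  define A where "A = \<bar>C - G\<bar>"
  have mu: "0 < \<mu>" "\<mu> \<le> 1" "\<mu> * c + \<mu> = 1" using c by (auto simp: \<mu>_def field_simps)
  then have "\<mu>\<^sup>2 \<le> \<mu>" by (simp add: power2_eq_square mult_left_le)
  define W where "W = (\<lambda>t x. (G + (A * exp t1) * exp (0 * x + (-1) * t)
      + (A * exp (\<mu> * z1)) * exp ((-\<mu>) * x + (-(\<mu> * c)) * t)) - v t x)"
  have W: "W t x = G + A * exp (t1 - t) + A * exp (\<mu> * (z1 - (x + c * t))) - v t x" for t x
  proof -
    have "exp t1 * exp (0 * x + (-1) * t) = exp (t1 - t)"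
      "exp (\<mu> * z1) * exp ((-\<mu>) * x + (-(\<mu> * c)) * t) = exp (\<mu> * (z1 - (x + c * t)))"
      by (auto simp: exp_add[symmetric] algebra_simps)
    then show ?thesis unfolding W_def by (simp only: mult.assoc)
  qed
  have A: "A \<ge> 0" "C \<le> G + A" by (auto simp: A_def)
  have "0 \<le> W t x"
  proof (rule comparison_principle_single[where W = W and h = 1 and start = t1])
    show "continuous_on (moving_half_plane c t1 z1) (\<lambda>(t, x). W t x)"
      using cont unfolding W_def case_prod_unfold by (intro continuous_intros)
    show "\<exists>B. \<forall>t x. (t, x) \<in> moving_half_plane c t1 z1 \<longrightarrow> t \<le> T \<longrightarrow> B \<le> W t x" for T
    proof (intro exI[of _ "G - C"] allI impI)
      fix t x assume "(t, x) \<in> moving_half_plane c t1 z1"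
      then have "v t x \<le> C" by (auto simp: moving_half_plane_def intro: bound)
      moreover have "A * exp (t1 - t) \<ge> 0" "A * exp (\<mu> * (z1 - (x + c * t))) \<ge> 0" using A by auto
      ultimately show "G - C \<le> W t x" unfolding W by linarith
    qed
    fix t x assume inD: "(t, x) \<in> moving_half_plane c t1 z1" and neg: "W t x < 0"
    have d: "t1 \<le> t" "z1 \<le> x + c * t" using inD by (auto simp: moving_half_plane_def)
    have pos: "A * exp (t1 - t) \<ge> 0" "A * exp (\<mu> * (z1 - (x + c * t))) \<ge> 0" using A by auto
    have "t \<noteq> t1"
    proof
      assume "t = t1"
      then have "A * exp (t1 - t) = A" by simp
      then show False using neg pos(2) bound[OF d] A(2) unfolding W by linarith
    qed
    moreover have "x + c * t \<noteq> z1"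
    proof
      assume "x + c * t = z1"
      then have "A * exp (\<mu> * (z1 - (x + c * t))) = A" by simp
      then show False using neg pos(1) bound[OF d] A(2) unfolding W by linarith
    qed
    ultimately have d': "t1 < t" "z1 < x + c * t" using d by auto
    obtain r where r: "r \<le> G" "has_parabolic_value v t x r" using sub[OF d'] by blast
    have "has_parabolic_value W t x
       ((G + (-1 - 0\<^sup>2 + 1) * ((A * exp t1) * exp (0 * x + (-1) * t))
         + (-(\<mu> * c) - (-\<mu>)\<^sup>2 + 1) * ((A * exp (\<mu> * z1)) * exp ((-\<mu>) * x + (-(\<mu> * c)) * t))) - r)"
      unfolding W_def
      by (intro has_parabolic_value_diff has_parabolic_value_add has_parabolic_value_exp
          has_parabolic_value_const r)
    moreover have "0 \<le> (-(\<mu> * c) - (-\<mu>)\<^sup>2 + 1) * ((A * exp (\<mu> * z1)) * exp ((-\<mu>) * x + (-(\<mu> * c)) * t))"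
      using \<open>\<mu>\<^sup>2 \<le> \<mu>\<close> mu A by (intro mult_nonneg_nonneg) auto
    ultimately show "(t, x) \<in> interior (moving_half_plane c t1 z1) \<and> (\<exists>r\<ge>0. has_parabolic_value W t x r)"
      using r(1) by (intro conjI interior_moving_half_plane d' exI) auto
  qed (use tx in \<open>auto simp: moving_half_plane_def intro: closed_moving_half_plane[unfolded moving_half_plane_def]\<close>)
  then show ?thesis unfolding W A_def[symmetric] by (simp add: \<mu>_def distrib_left)
qed

text \<open>
The filter of \<open>t \<rightarrow> \<infinity>\<close> and \<open>x + c * t \<rightarrow> \<infinity>\<close>: the region swept by the wave, which
travels to the left. Its events are stable under a fixed time delay, and a statement about it
specialises to the limit of a profile at \<open>+\<infinity>\<close>.
\<close>

definition behind_front :: "real \<Rightarrow> (real \<times> real) filter" where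
  "behind_front c = filtercomap (\<lambda>(t, x). min t (x + c * t)) at_top"

lemma eventually_behind_front:
  "eventually P (behind_front c) \<longleftrightarrow> (\<exists>N. \<forall>t x. N \<le> t \<longrightarrow> N \<le> x + c * t \<longrightarrow> P (t, x))"
  unfolding behind_front_def eventually_filtercomap_at_top_linorder by auto

lemma eventually_behind_frontE:
  assumes "eventually P (behind_front c)"
  obtains N where "N \<ge> N0" "\<And>t x. N \<le> t \<Longrightarrow> N \<le> x + c * t \<Longrightarrow> P (t, x)"
proof -
  obtain N where "\<And>t x. N \<le> t \<Longrightarrow> N \<le> x + c * t \<Longrightarrow> P (t, x)"
    using assms unfolding eventually_behind_front by blast
  then show ?thesis by (intro that[of "max N N0"]) auto
qed

lemma behind_front_neq_bot: "behind_front c \<noteq> bot"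
proof
  assume "behind_front c = bot"
  then have "eventually (\<lambda>_. False) (behind_front c)" by simp
  then obtain N where "\<And>t x. N \<le> t \<Longrightarrow> N \<le> x + c * t \<Longrightarrow> False"
    unfolding eventually_behind_front by blast
  from this[of N "N - c * N"] show False by simp
qed

lemma eventually_behind_front_delayed:
  assumes "eventually P (behind_front c)" "c \<ge> 0" "h \<ge> 0"
  shows "eventually (\<lambda>(t, x). P (t - h, x)) (behind_front c)"
proof -
  obtain N where N: "\<And>t x. N \<le> t \<Longrightarrow> N \<le> x + c * t \<Longrightarrow> P (t, x)"
    using assms unfolding eventually_behind_front by blast
  have "P (t - h, x)" if "N + h + c * h \<le> t" "N + h + c * h \<le> x + c * t" for t x
  proof -
    have "c * h \<ge> 0" using assms by simp
    then have "N \<le> t - h" "N \<le> x + (c * t - c * h)" using that assms by linarith+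
    then have "N \<le> t - h" "N \<le> x + c * (t - h)" by (simp_all add: right_diff_distrib)
    then show ?thesis by (rule N)
  qed
  then show ?thesis unfolding eventually_behind_front by auto
qed

lemma eventually_behind_front_upper:
  assumes c: "c > 0" and cont: "continuous_on ({0..} \<times> UNIV) (\<lambda>(t, x). v t x)"
    and bound: "eventually (\<lambda>(t, x). v t x \<le> C) (behind_front c)"
    and sub: "eventually (\<lambda>(t, x). \<exists>r\<le>G. has_parabolic_value v t x r) (behind_front c)"
    and e: "e > 0"
  shows "eventually (\<lambda>(t, x). v t x \<le> G + e) (behind_front c)"
proof -
  have "eventually (\<lambda>(t, x). v t x \<le> C \<and> (\<exists>r\<le>G. has_parabolic_value v t x r)) (behind_front c)"
    using eventually_conj[OF bound sub] by (simp add: case_prod_unfold)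
  then obtain N where N: "N \<ge> 0" "\<And>t x. N \<le> t \<Longrightarrow> N \<le> x + c * t \<Longrightarrow>
      v t x \<le> C \<and> (\<exists>r\<le>G. has_parabolic_value v t x r)"
    by (rule eventually_behind_frontE[where ?N0.0 = 0]) auto
  define A where "A = \<bar>C - G\<bar> + 1"
  \<comment> \<open>A decaying term with exponent at most \<open>- l\<close> contributes at most \<open>e / 2\<close> after multiplication by \<open>A\<close>.\<close>
  define l where "l = ln (2 * A / e)"
  have A: "A > 0" by (simp add: A_def)
  have l: "exp (- l) = e / (2 * A)" using A e by (simp add: l_def exp_minus)
  define N' where "N' = N + \<bar>l\<bar> * (c + 1)"
  have N': "N' \<ge> N" "N' - N \<ge> \<bar>l\<bar>" "(N' - N) / (c + 1) \<ge> \<bar>l\<bar>"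
  proof -
    have "\<bar>l\<bar> * 1 \<le> \<bar>l\<bar> * (c + 1)" using c by (intro mult_left_mono) auto
    then show "N' \<ge> N" "N' - N \<ge> \<bar>l\<bar>" by (auto simp: N'_def)
    show "(N' - N) / (c + 1) \<ge> \<bar>l\<bar>" using c by (simp add: N'_def)
  qed
  have "v t x \<le> G + e" if tx: "N' \<le> t" "N' \<le> x + c * t" for t x
  proof -
    have "v t x \<le> G + \<bar>C - G\<bar> * (exp (N - t) + exp ((N - (x + c * t)) / (c + 1)))"
    proof (rule upper_relaxation[OF c])
      show "continuous_on (moving_half_plane c N N) (\<lambda>(t, x). v t x)"
        by (rule continuous_on_subset[OF cont]) (use N in \<open>auto simp: moving_half_plane_def\<close>)
    qed (use tx N N' in auto)
    also have "\<dots> \<le> G + A * (e / (2 * A) + e / (2 * A))"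
    proof -
      have "exp (N - t) \<le> e / (2 * A)" unfolding l[symmetric] using N' tx by simp
      moreover have "exp ((N - (x + c * t)) / (c + 1)) \<le> e / (2 * A)"
      proof -
        have "(N' - N) / (c + 1) \<le> ((x + c * t) - N) / (c + 1)"
          using c tx by (intro divide_right_mono) auto
        then have "\<bar>l\<bar> \<le> ((x + c * t) - N) / (c + 1)" using N' by linarith
        then have "l \<le> - ((N - (x + c * t)) / (c + 1))" by (simp add: minus_divide_left)
        then show ?thesis unfolding l[symmetric] by simp
      qed
      ultimately have "\<bar>C - G\<bar> * (exp (N - t) + exp ((N - (x + c * t)) / (c + 1)))
          \<le> A * (e / (2 * A) + e / (2 * A))"
        by (intro mult_mono) (auto simp: A_def)
      then show ?thesis by simp
    qed
    also have "\<dots> = G + e" using A by (simp add: field_simps)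
    finally show ?thesis .
  qed
  then show ?thesis unfolding eventually_behind_front by auto
qed

lemma eventually_behind_front_lower:
  assumes c: "c > 0" and cont: "continuous_on ({0..} \<times> UNIV) (\<lambda>(t, x). v t x)"
    and bound: "eventually (\<lambda>(t, x). a \<le> v t x) (behind_front c)"
    and sup: "eventually (\<lambda>(t, x). \<exists>r\<ge>G. has_parabolic_value v t x r) (behind_front c)"
    and e: "e > 0"
  shows "eventually (\<lambda>(t, x). G - e \<le> v t x) (behind_front c)"
proof -
  have "eventually (\<lambda>(t, x). - v t x \<le> - G + e) (behind_front c)"
  proof (rule eventually_behind_front_upper[OF c _ _ _ e, of "\<lambda>t x. - v t x" "- a"])
    show "continuous_on ({0..} \<times> UNIV) (\<lambda>(t, x). - v t x)"
      using cont unfolding case_prod_unfold by (intro continuous_intros)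
    show "eventually (\<lambda>(t, x). \<exists>r\<le>- G. has_parabolic_value (\<lambda>t x. - v t x) t x r) (behind_front c)"
      using sup
    proof eventually_elim
      case (elim p)
      obtain t x where p: "p = (t, x)" by fastforce
      then obtain r where "r \<ge> G" "has_parabolic_value v t x r" using elim by auto
      then show ?case
        using has_parabolic_value_minus[of v t x r] p by (auto intro!: exI[of _ "- r"])
    qed
  qed (use bound in simp)
  then show ?thesis by eventually_elim auto
qed

context unimodal_birth
begin

lemma g_near_interval:
  assumes "0 < m" "m \<le> M" "0 < e" "e \<le> m" "m - e \<le> x" "x \<le> M + e"
  obtains p where "p \<in> {m..M}" "\<bar>g x - g p\<bar> \<le> deriv g 0 * e"
proof -
  define p where "p = max m (min M x)"
  have p: "p \<in> {m..M}" "\<bar>x - p\<bar> \<le> e" using assms by (auto simp: p_def)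
  have "\<bar>g x - g p\<bar> \<le> deriv g 0 * \<bar>x - p\<bar>" using assms p by (intro lipschitz) auto
  also have "\<dots> \<le> deriv g 0 * e" using p slope0 by (intro mult_left_mono) auto
  finally show ?thesis using p that by blast
qed

text \<open>
Let \<open>m\<close> and \<open>M\<close> be the limits inferior and superior of \<open>v\<close>. Up to \<open>e\<close>, the delayed values
eventually lie in \<open>[m, M]\<close>, so the source lies between the extrema of \<open>g\<close> on this interval up to
\<open>g'(0) * e\<close>, and relaxation carries this over to \<open>v\<close>. Letting \<open>e\<close> tend to \<open>0\<close> yields
\<open>M \<le> max g\<close> and \<open>min g \<le> m\<close> on \<open>[m, M]\<close>.
\<close>

theorem converges_to_kappa_behind_front:
  assumes h: "h > 0" and c: "c > 0" and sol: "classical_solution h g v" and a: "a > 0"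
    and bounds: "eventually (\<lambda>(t, x). a \<le> v t x \<and> v t x \<le> C) (behind_front c)"
  shows "((\<lambda>(t, x). v t x) \<longlongrightarrow> \<kappa>) (behind_front c)"
proof -
  define U where "U = {b. eventually (\<lambda>(t, x). v t x \<le> b) (behind_front c)}"
  define L where "L = {b. eventually (\<lambda>(t, x). b \<le> v t x) (behind_front c)}"
  have LU: "b \<le> b'" if "b \<in> L" "b' \<in> U" for b b'
  proof -
    have "eventually (\<lambda>(t, x). b \<le> v t x) (behind_front c)" "eventually (\<lambda>(t, x). v t x \<le> b') (behind_front c)"
      using that by (auto simp: L_def U_def)
    then have "eventually (\<lambda>_. b \<le> b') (behind_front c)" by eventually_elim auto
    then show ?thesis using behind_front_neq_bot by (simp add: eventually_const)
  qed
  have "C \<in> U" unfolding U_def using bounds by (auto elim!: eventually_mono)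
  have "a \<in> L" unfolding L_def using bounds by (auto elim!: eventually_mono)
  define M where "M = Inf U"
  define m where "m = Sup L"
  have bdd: "bdd_below U" "bdd_above L" using LU \<open>C \<in> U\<close> \<open>a \<in> L\<close> by (auto simp: bdd_below_def bdd_above_def)
  have m_le: "m \<le> b" if "b \<in> U" for b unfolding m_def using \<open>a \<in> L\<close> LU that by (intro cSup_least) auto
  have mM: "m \<le> M" unfolding M_def using \<open>C \<in> U\<close> m_le by (intro cInf_greatest) auto
  have "a \<le> m" unfolding m_def using \<open>a \<in> L\<close> bdd by (intro cSup_upper)
  then have m: "m > 0" using a by simp
  have up: "eventually (\<lambda>(t, x). v t x \<le> M + e) (behind_front c)" if "e > 0" for e
  proof -
    obtain b where b: "b \<in> U" "b < M + e"
      using cInf_lessD[of U "M + e"] \<open>C \<in> U\<close> \<open>e > 0\<close> unfolding M_def by auto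
    then have "eventually (\<lambda>(t, x). v t x \<le> b) (behind_front c)" by (simp add: U_def)
    then show ?thesis by eventually_elim (use b in auto)
  qed
  have low: "eventually (\<lambda>(t, x). m - e \<le> v t x) (behind_front c)" if "e > 0" for e
  proof -
    obtain b where b: "b \<in> L" "m - e < b"
      using less_cSupD[of L "m - e"] \<open>a \<in> L\<close> \<open>e > 0\<close> unfolding m_def by auto
    then have "eventually (\<lambda>(t, x). b \<le> v t x) (behind_front c)" by (simp add: L_def)
    then show ?thesis by eventually_elim (use b in auto)
  qed
  have cont: "continuous_on ({0..} \<times> UNIV) (\<lambda>(t, x). v t x)"
    using classical_solution_continuous[OF sol]
    by (rule continuous_on_subset) (use h in auto)
  have gM: "continuous_on {m..M} g" using continuous_on_subset[OF cont_nonneg, of "{m..M}"] m by auto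
  have "\<exists>y\<in>{m..M}. \<forall>z\<in>{m..M}. g z \<le> g y"
    using mM gM by (intro continuous_attains_sup) auto
  then obtain y where y: "y \<in> {m..M}" "\<And>z. z \<in> {m..M} \<Longrightarrow> g z \<le> g y" by blast
  have "\<exists>y\<in>{m..M}. \<forall>z\<in>{m..M}. g y \<le> g z"
    using mM gM by (intro continuous_attains_inf) auto
  then obtain y' where y': "y' \<in> {m..M}" "\<And>z. z \<in> {m..M} \<Longrightarrow> g y' \<le> g z" by blast
  have source: "eventually (\<lambda>(t, x). has_parabolic_value v t x (g (v (t - h) x)) \<and>
       g (v (t - h) x) \<le> g y + deriv g 0 * e \<and> g y' - deriv g 0 * e \<le> g (v (t - h) x)) (behind_front c)"
    if "0 < e" "e \<le> m" for e
  proof -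
    have "eventually (\<lambda>(t, x). 1 \<le> t) (behind_front c)" unfolding eventually_behind_front by auto
    moreover have "eventually (\<lambda>(t, x). v (t - h) x \<le> M + e) (behind_front c)"
      using eventually_behind_front_delayed[OF up] that h c by simp
    moreover have "eventually (\<lambda>(t, x). m - e \<le> v (t - h) x) (behind_front c)"
      using eventually_behind_front_delayed[OF low] that h c by simp
    ultimately show ?thesis
    proof eventually_elim
      case (elim p)
      obtain t x where p: "p = (t, x)" by fastforce
      have tx: "1 \<le> t" "v (t - h) x \<le> M + e" "m - e \<le> v (t - h) x" using elim p by auto
      obtain z where "z \<in> {m..M}" "\<bar>g (v (t - h) x) - g z\<bar> \<le> deriv g 0 * e"
        by (rule g_near_interval[OF m mM \<open>0 < e\<close> \<open>e \<le> m\<close> tx(3,2)])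
      then show ?case
        using y(2)[of z] y'(2)[of z] classical_solution_parabolic[OF sol, of t x] tx p by auto
    qed
  qed
  have approx: "M \<le> g y + e \<and> g y' - e \<le> m" if "e > 0" for e
  proof -
    \<comment> \<open>The tolerance is spent once as \<open>d\<close> in the relaxation and once as \<open>g'(0) * d\<close> in the source.\<close>
    define d where "d = min m (e / (deriv g 0 + 1))"
    have d: "0 < d" "d \<le> m" "deriv g 0 * d + d \<le> e"
    proof -
      have "(deriv g 0 + 1) * d \<le> (deriv g 0 + 1) * (e / (deriv g 0 + 1))"
        using slope0 by (intro mult_left_mono) (auto simp: d_def)
      also have "\<dots> = e" using slope0 by simp
      finally show "deriv g 0 * d + d \<le> e" by (simp add: distrib_right)
    qed (use m slope0 that in \<open>auto simp: d_def\<close>)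
    have "eventually (\<lambda>(t, x). v t x \<le> g y + deriv g 0 * d + d) (behind_front c)"
    proof (rule eventually_behind_front_upper[OF c cont _ _ d(1)])
      show "eventually (\<lambda>(t, x). v t x \<le> C) (behind_front c)"
        using bounds by eventually_elim auto
      show "eventually (\<lambda>(t, x). \<exists>r\<le>g y + deriv g 0 * d. has_parabolic_value v t x r) (behind_front c)"
        using source[OF d(1,2)] by eventually_elim auto
    qed
    then have "g y + deriv g 0 * d + d \<in> U" by (simp add: U_def)
    then have "M \<le> g y + deriv g 0 * d + d" unfolding M_def using bdd by (intro cInf_lower)
    moreover have "eventually (\<lambda>(t, x). (g y' - deriv g 0 * d) - d \<le> v t x) (behind_front c)"
    proof (rule eventually_behind_front_lower[OF c cont _ _ d(1)])
      show "eventually (\<lambda>(t, x). a \<le> v t x) (behind_front c)"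
        using bounds by eventually_elim auto
      show "eventually (\<lambda>(t, x). \<exists>r\<ge>g y' - deriv g 0 * d. has_parabolic_value v t x r) (behind_front c)"
        using source[OF d(1,2)] by eventually_elim auto
    qed
    then have "g y' - deriv g 0 * d - d \<in> L" by (simp add: L_def)
    then have "g y' - deriv g 0 * d - d \<le> m" unfolding m_def using bdd by (intro cSup_upper)
    ultimately show ?thesis using d(3) by linarith
  qed
  have "M \<le> g y" by (rule field_le_epsilon) (rule conjunct1[OF approx])
  moreover have "g y' \<le> m"
  proof (rule field_le_epsilon)
    show "g y' \<le> m + e" if "e > 0" for e using approx[OF that] by linarith
  qed
  ultimately have "m = \<kappa>" "M = \<kappa>" using invariant_interval_trivial[OF m mM y(1) _ y'(1)] by auto
  show ?thesis
  proof (rule order_tendstoI)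
    fix b assume "b < \<kappa>"
    then have "eventually (\<lambda>(t, x). \<kappa> - (\<kappa> - b) / 2 \<le> v t x) (behind_front c)"
      using low[of "(\<kappa> - b) / 2"] \<open>m = \<kappa>\<close> by simp
    then show "eventually (\<lambda>p. b < (case p of (t, x) \<Rightarrow> v t x)) (behind_front c)"
      by eventually_elim (use \<open>b < \<kappa>\<close> in \<open>auto simp: field_simps\<close>)
  next
    fix b assume "\<kappa> < b"
    then have "eventually (\<lambda>(t, x). v t x \<le> \<kappa> + (b - \<kappa>) / 2) (behind_front c)"
      using up[of "(b - \<kappa>) / 2"] \<open>M = \<kappa>\<close> by simp
    then show "eventually (\<lambda>p. (case p of (t, x) \<Rightarrow> v t x) < b) (behind_front c)"
      by eventually_elim (use \<open>\<kappa> < b\<close> in \<open>auto simp: field_simps\<close>)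
  qed
qed

end

section \<open>Persistence behind the front\<close>

text \<open>
Dropping the nonnegative delayed source leaves a heat equation with absorption. For it the square of
\<open>s = 1 - exp (- y)\<close> in the coordinate \<open>y = x - X + \<sigma> * t\<close>, damped by \<open>exp (- K * t)\<close>, is a
subsolution vanishing on the boundary \<open>y = 0\<close>: there \<open>v_xx\<close> is strictly positive, and away from the
boundary the damping dominates, with \<open>K\<close> from the discriminant of a quadratic in \<open>s\<close>. The speed
\<open>\<sigma>\<close> is arbitrary.
\<close>

lemma expanding_front_lower_bound:
  assumes h: "h > 0" and sol: "classical_solution h g u"
    and g: "\<And>y. 0 \<le> y \<Longrightarrow> 0 \<le> g y"
    and nonneg: "\<And>t x. -h \<le> t \<Longrightarrow> 0 \<le> u t x"
    and init: "\<And>x. X \<le> x \<Longrightarrow> a \<le> u 0 x" and a: "0 \<le> a" and "0 \<le> \<sigma>"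
    and t: "0 \<le> t" "X \<le> x + \<sigma> * t"
  shows "a * (exp (- ((6 + 2 * \<sigma>)\<^sup>2 / 8 * t)) * (1 - exp (X - (x + \<sigma> * t)))\<^sup>2) \<le> u t x"
proof -
  define K where "K = (6 + 2 * \<sigma>)\<^sup>2 / 8"
  define S where "S = (\<lambda>t x. 1 - exp (X - (x + \<sigma> * t)))"
  define v where "v = (\<lambda>t x. a * (exp (- (K * t)) * (S t x)\<^sup>2))"
  define D where "D = moving_half_plane \<sigma> 0 X"
  have S: "0 \<le> S t x" "S t x \<le> 1" if "(t, x) \<in> D" for t x
    using that by (auto simp: S_def D_def moving_half_plane_def)
  have v0: "0 \<le> v t x" for t x using a by (simp add: v_def)
  have va: "v t x \<le> a" if "(t, x) \<in> D" for t x
  proof -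
    have "exp (- (K * t)) * (S t x)\<^sup>2 \<le> 1 * 1"
      using that S[OF that]
      by (intro mult_mono) (auto simp: D_def moving_half_plane_def K_def power_le_one)
    then show ?thesis using a mult_left_mono[of _ 1 a] by (simp add: v_def)
  qed
  have hpv: "has_parabolic_value v t x
      (a * exp (- (K * t)) * (- (K * (S t x)\<^sup>2) + 2 * \<sigma> * S t x * (1 - S t x)
         - (2 * (1 - S t x)\<^sup>2 - 2 * S t x * (1 - S t x)) + (S t x)\<^sup>2))" for t x
    unfolding has_parabolic_value_def v_def S_def
    by (intro exI[of _ "a * (exp (- (K * t)) * (- (K * (S t x)\<^sup>2) + 2 * \<sigma> * S t x * (1 - S t x)))"]
        exI[of _ "\<lambda>x. a * (exp (- (K * t)) * (2 * S t x * (1 - S t x)))"]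
        exI[of _ "a * (exp (- (K * t)) * (2 * (1 - S t x)\<^sup>2 - 2 * S t x * (1 - S t x)))"])
       (auto intro!: derivative_eq_intros simp: S_def algebra_simps power2_eq_square)
  have neg: "- (K * s\<^sup>2) + 2 * \<sigma> * s * (1 - s) - (2 * (1 - s)\<^sup>2 - 2 * s * (1 - s)) + s\<^sup>2 \<le> 0"
    if "0 \<le> s" for s
  proof -
    have "- (K * s\<^sup>2) + 2 * \<sigma> * s * (1 - s) - (2 * (1 - s)\<^sup>2 - 2 * s * (1 - s)) + s\<^sup>2
      = - (2 * (1 - (6 + 2 * \<sigma>) * s / 4)\<^sup>2) - (3 + 2 * \<sigma>) * s\<^sup>2"
      by (simp add: K_def field_simps power2_eq_square)
    moreover have "0 \<le> (3 + 2 * \<sigma>) * s\<^sup>2" using \<open>0 \<le> \<sigma>\<close> by simp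
    moreover have "0 \<le> 2 * (1 - (6 + 2 * \<sigma>) * s / 4)\<^sup>2" by simp
    ultimately show ?thesis by linarith
  qed
  have sub: "D \<subseteq> {-h..} \<times> UNIV" using h by (auto simp: D_def moving_half_plane_def)
  have "0 \<le> u t x - v t x"
  proof (rule comparison_principle_single[where D = D and h = h and start = 0 and W = "\<lambda>t x. u t x - v t x"])
    show "continuous_on D (\<lambda>(t, x). u t x - v t x)"
      using continuous_on_subset[OF classical_solution_continuous[OF sol] sub]
      unfolding case_prod_unfold v_def S_def by (intro continuous_intros)
    show "\<exists>B. \<forall>t x. (t, x) \<in> D \<longrightarrow> t \<le> T \<longrightarrow> B \<le> u t x - v t x" for T
    proof (intro exI[of _ "- a"] allI impI)
      fix t x assume "(t, x) \<in> D"
      then show "- a \<le> u t x - v t x" using va[of t x] nonneg[of t x] sub by force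
    qed
    fix t x assume tx: "(t, x) \<in> D" and neg': "u t x - v t x < 0"
    then have d: "0 \<le> t" "X \<le> x + \<sigma> * t" by (auto simp: D_def moving_half_plane_def)
    have "t \<noteq> 0" using neg' va[OF tx] init[of x] d by auto
    moreover have "x + \<sigma> * t \<noteq> X"
    proof
      assume "x + \<sigma> * t = X"
      then have "v t x = 0" by (simp add: v_def S_def)
      then show False using neg' nonneg[of t x] h d by simp
    qed
    ultimately have d: "0 < t" "X < x + \<sigma> * t" using d by auto
    have "0 \<le> g (u (t - h) x)" using d by (intro g nonneg) auto
    moreover have "a * exp (- (K * t)) * (- (K * (S t x)\<^sup>2) + 2 * \<sigma> * S t x * (1 - S t x)
         - (2 * (1 - S t x)\<^sup>2 - 2 * S t x * (1 - S t x)) + (S t x)\<^sup>2) \<le> 0"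
      using a neg[OF S(1)[OF tx]] by (intro mult_nonneg_nonpos) auto
    ultimately show "(t, x) \<in> interior D \<and> (\<exists>r\<ge>0. has_parabolic_value (\<lambda>t x. u t x - v t x) t x r)"
      using has_parabolic_value_diff[OF classical_solution_parabolic[OF sol d(1)] hpv, of x] d
      unfolding D_def by (intro conjI interior_moving_half_plane exI) (auto intro: order_trans)
  qed (use h t in \<open>auto simp: D_def moving_half_plane_def intro: closed_moving_half_plane[unfolded moving_half_plane_def]\<close>)
  then show ?thesis by (simp add: v_def S_def K_def)
qed

text \<open>
Positivity spreads from \<open>x \<ge> X\<close> with a speed \<open>\<sigma>\<close> so large that by time \<open>h\<close> it has overtaken the
line \<open>x + c * t = z\<close> with a margin of one.
\<close>

lemma positive_near_front:
  assumes h: "h > 0" and c: "c > 0" and sol: "classical_solution h g u"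
    and g: "\<And>y. 0 \<le> y \<Longrightarrow> 0 \<le> g y"
    and nonneg: "\<And>t x. -h \<le> t \<Longrightarrow> 0 \<le> u t x"
    and init: "\<And>x. X \<le> x \<Longrightarrow> a \<le> u 0 x" and a: "0 < a"
  shows "\<exists>b>0. \<forall>t x. h \<le> t \<longrightarrow> t \<le> T \<longrightarrow> z \<le> x + c * t \<longrightarrow> b \<le> u t x"
proof -
  \<comment> \<open>For \<open>t \<ge> h\<close> this gives \<open>(\<sigma> - c) * t \<ge> 1 + \<bar>z\<bar> + \<bar>X\<bar>\<close>.\<close>
  define \<sigma> where "\<sigma> = c + (1 + \<bar>z\<bar> + \<bar>X\<bar>) / h"
  define K where "K = (6 + 2 * \<sigma>)\<^sup>2 / 8"
  have sig: "0 \<le> \<sigma>" using c h by (auto simp: \<sigma>_def intro!: add_nonneg_nonneg)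
  define b where "b = a * (exp (- (K * T)) * (1 - exp (-1))\<^sup>2)"
  have "b \<le> u t x" if "h \<le> t" "t \<le> T" "z \<le> x + c * t" for t x
  proof -
    have "(1 + \<bar>z\<bar> + \<bar>X\<bar>) / h * h \<le> (1 + \<bar>z\<bar> + \<bar>X\<bar>) / h * t"
      using that h by (intro mult_left_mono) auto
    then have "1 + \<bar>z\<bar> + \<bar>X\<bar> \<le> (\<sigma> - c) * t" using h by (simp add: \<sigma>_def)
    then have y: "X + 1 \<le> x + \<sigma> * t" using that by (simp add: algebra_simps)
    have "exp (- (K * T)) * (1 - exp (-1))\<^sup>2 \<le> exp (- (K * t)) * (1 - exp (X - (x + \<sigma> * t)))\<^sup>2"
    proof (rule mult_mono)
      have "K * t \<le> K * T" using that by (intro mult_left_mono) (auto simp: K_def)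
      then show "exp (- (K * T)) \<le> exp (- (K * t))" by simp
      show "(1 - exp (-1))\<^sup>2 \<le> (1 - exp (X - (x + \<sigma> * t)))\<^sup>2"
        using y by (intro power_mono) auto
    qed auto
    then have "b \<le> a * (exp (- (K * t)) * (1 - exp (X - (x + \<sigma> * t)))\<^sup>2)"
      using a unfolding b_def by (intro mult_left_mono) auto
    also have "\<dots> \<le> u t x"
      unfolding K_def using y that h a
      by (intro expanding_front_lower_bound[OF h sol g nonneg init _ sig]) auto
    finally show ?thesis .
  qed
  moreover have "b > 0" using a by (simp add: b_def)
  ultimately show ?thesis by blast
qed

context unimodal_birth
begin

text \<open>
The level \<open>a'\<close> is below the values on the strip \<open>x + c * t \<in> [- c h, 0]\<close>, below those during a
time interval of length \<open>h\<close>, and not above \<open>g\<close> on \<open>[a', B]\<close>. A strip of width \<open>c * h\<close> is what the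
delay consumes: a point with \<open>x + c * t > 0\<close> looks back at one with \<open>x + c * (t - h) > - c h\<close>.
\<close>

lemma persistence:
  assumes h: "h > 0" and c: "c > 0" and sol: "classical_solution h g u"
    and range: "\<And>t x. -h \<le> t \<Longrightarrow> 0 \<le> u t x \<and> u t x \<le> B"
    and init: "\<And>x. X \<le> x \<Longrightarrow> a \<le> u 0 x" "0 < a"
    and boundary: "\<And>t x. T0 \<le> t \<Longrightarrow> x + c * t \<in> {- (c * h)..0} \<Longrightarrow> b \<le> u t x" "0 < b"
  obtains a' where "0 < a'" "eventually (\<lambda>(t, x). a' \<le> u t x) (behind_front c)"
proof -
  define T where "T = \<bar>T0\<bar> + 2 * h"
  have T: "T0 \<le> T - h" "h \<le> T - h" using h by (auto simp: T_def)
  have "\<exists>b>0. \<forall>t x. h \<le> t \<longrightarrow> t \<le> T \<longrightarrow> - (c * h) \<le> x + c * t \<longrightarrow> b \<le> u t x"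
    by (rule positive_near_front[OF h c sol g_nonneg _ init]) (use range in auto)
  then obtain b1 where
    b1: "b1 > 0" "\<And>t x. h \<le> t \<Longrightarrow> t \<le> T \<Longrightarrow> - (c * h) \<le> x + c * t \<Longrightarrow> b1 \<le> u t x"
    by blast
  have "0 < \<bar>B\<bar> + 1" by simp
  then obtain a0 where a0: "a0 > 0"
    "\<And>a v. 0 < a \<Longrightarrow> a \<le> a0 \<Longrightarrow> a \<le> v \<Longrightarrow> v \<le> \<bar>B\<bar> + 1 \<Longrightarrow> a \<le> g v"
    using persistence_level[of "\<bar>B\<bar> + 1"] by blast
  define a' where "a' = min b (min b1 a0)"
  have a': "0 < a'" "a' \<le> b" "a' \<le> b1" "a' \<le> a0" using b1 a0 boundary(2) by (auto simp: a'_def)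
  define D where "D = moving_half_plane c (T - h) (- (c * h))"
  have D: "(t, x) \<in> D \<longleftrightarrow> T - h \<le> t \<and> - (c * h) \<le> x + c * t" for t x
    by (simp add: D_def moving_half_plane_def)
  have sub: "D \<subseteq> {-h..} \<times> UNIV" using h T by (auto simp: D)
  have bound: "0 \<le> u t x - a'" if "(t, x) \<in> D" for t x
  proof (rule comparison_principle_single[where D = D and h = h and start = "T - h" and W = "\<lambda>t x. u t x - a'"])
    show "continuous_on D (\<lambda>(t, x). u t x - a')"
      using continuous_on_subset[OF classical_solution_continuous[OF sol] sub]
      unfolding case_prod_unfold by (intro continuous_intros)
    show "\<exists>b. \<forall>t x. (t, x) \<in> D \<longrightarrow> t \<le> S \<longrightarrow> b \<le> u t x - a'" for S
    proof (intro exI[of _ "- a'"] allI impI)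
      fix t x assume "(t, x) \<in> D"
      then show "- a' \<le> u t x - a'" using range[of t x] sub by auto
    qed
    fix t x assume tx: "(t, x) \<in> D" and neg: "u t x - a' < 0"
      and earlier: "\<And>s y. (s, y) \<in> D \<Longrightarrow> s \<le> t - h \<Longrightarrow> 0 \<le> u s y - a'"
    have d: "T - h \<le> t" "- (c * h) \<le> x + c * t" using tx by (auto simp: D)
    have t: "T < t"
    proof (rule ccontr)
      assume "\<not> T < t"
      then have "b1 \<le> u t x" using d T by (intro b1) auto
      then show False using neg a' by simp
    qed
    have x: "0 < x + c * t"
    proof (rule ccontr)
      assume "\<not> 0 < x + c * t"
      then have "b \<le> u t x" using d T by (intro boundary) auto
      then show False using neg a' by simp
    qed
    have "0 < t" using t T h by linarith
    have "(t - h, x) \<in> D" using t x by (simp add: D right_diff_distrib)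
    then have "a' \<le> u (t - h) x" using earlier[of "t - h" x] by simp
    moreover have "u (t - h) x \<le> \<bar>B\<bar> + 1" using range[of "t - h" x] \<open>0 < t\<close> by simp
    ultimately have "a' \<le> g (u (t - h) x)" using a0(2) a' by blast
    moreover have "0 < c * h" using c h by simp
    ultimately show "(t, x) \<in> interior D \<and> (\<exists>r\<ge>0. has_parabolic_value (\<lambda>t x. u t x - a') t x r)"
      using has_parabolic_value_diff[OF classical_solution_parabolic[OF sol \<open>0 < t\<close>] has_parabolic_value_const, of a' x]
        t x h
      unfolding D_def by (intro conjI interior_moving_half_plane exI[of _ "g (u (t - h) x) - a'"]) auto
  next
    show "closed D" unfolding D_def by (rule closed_moving_half_plane)
  qed (use h that in \<open>auto simp: D\<close>)
  have "eventually (\<lambda>(t, x). a' \<le> u t x) (behind_front c)"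
    unfolding eventually_behind_front
  proof (intro exI[of _ "\<bar>T\<bar>"] allI impI)
    fix t x assume "\<bar>T\<bar> \<le> t" "\<bar>T\<bar> \<le> x + c * t"
    moreover have "0 < c * h" using c h by simp
    ultimately have "T - h \<le> t" "- (c * h) \<le> x + c * t" using h by linarith+
    then have "(t, x) \<in> D" by (simp add: D)
    then show "case (t, x) of (t, x) \<Rightarrow> a' \<le> u t x" using bound by fastforce
  qed
  then show ?thesis using that a' by blast
qed

end

section \<open>Exponential closeness of two solutions\<close>

context unimodal_birth
begin

text \<open>
The weight of the initial estimate is \<open>exp (lam * x)\<close> at every \<open>s\<close>, rather than
\<open>exp (lam * (x + c * s))\<close>; the factor \<open>exp (lam * c * h)\<close> compensates for this.
\<close>

lemma exponential_closeness_at_rear: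
  assumes h: "h > 0" and u: "classical_solution h g u" and p: "classical_solution h g p"
    and nonneg: "\<And>t x. -h \<le> t \<Longrightarrow> 0 \<le> u t x" "\<And>t x. -h \<le> t \<Longrightarrow> 0 \<le> p t x"
    and c: "c > 0" and lam: "lam > 0" and \<gamma>: "0 \<le> \<gamma>" and N: "0 \<le> N"
    and rate: "deriv g 0 * exp (- lam * c * h) * exp (\<gamma> * h) \<le> lam * c - lam\<^sup>2 + 1 - \<gamma>"
    and init: "\<And>s x. s \<in> {-h..0} \<Longrightarrow> \<bar>u s x - p s x\<bar> \<le> N * exp (lam * x)"
    and t: "-h \<le> t"
  shows "\<bar>u t x - p t x\<bar> \<le> N * exp (lam * c * h) * exp (lam * (x + c * t) - \<gamma> * t)"
proof -
  have "\<bar>u t x - p t x\<bar> \<le> N * exp (lam * c * h) * exp (lam * x + (lam * c - \<gamma>) * t)"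
  proof (rule exponential_difference_bound[OF h u p, where D = "{-h..} \<times> UNIV" and q = "deriv g 0"])
    show "deriv g 0 * exp (- ((lam * c - \<gamma>) * h)) \<le> lam * c - \<gamma> - lam\<^sup>2 + 1"
      using rate by (simp add: mult.assoc exp_add[symmetric] algebra_simps)
    fix t x assume tx: "(t, x) \<in> {-h..} \<times> (UNIV :: real set)"
    show "\<bar>u t x - p t x\<bar> \<le> N * exp (lam * c * h) * exp (lam * x + (lam * c - \<gamma>) * t) \<or>
       0 < t \<and> (t, x) \<in> interior ({-h..} \<times> UNIV) \<and> (t - h, x) \<in> {-h..} \<times> UNIV \<and>
       \<bar>g (u (t - h) x) - g (p (t - h) x)\<bar> \<le> deriv g 0 * \<bar>u (t - h) x - p (t - h) x\<bar>"
    proof (cases "t \<le> 0")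
      case True
      have "0 \<le> lam * c * (h + t)" using tx lam c by (intro mult_nonneg_nonneg) auto
      moreover have "\<gamma> * t \<le> 0" using True \<gamma> by (rule mult_nonneg_nonpos[rotated])
      ultimately have "lam * x \<le> lam * c * h + (lam * x + (lam * c - \<gamma>) * t)" by (simp add: algebra_simps)
      then have "N * exp (lam * x) \<le> N * exp (lam * c * h + (lam * x + (lam * c - \<gamma>) * t))"
        using N by (intro mult_left_mono) auto
      moreover have "\<bar>u t x - p t x\<bar> \<le> N * exp (lam * x)" using True tx by (intro init) auto
      ultimately show ?thesis by (simp add: exp_add mult.assoc)
    next
      case False
      then have "0 < t" by simp
      then have "\<bar>g (u (t - h) x) - g (p (t - h) x)\<bar> \<le> deriv g 0 * \<bar>u (t - h) x - p (t - h) x\<bar>"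
        by (intro lipschitz nonneg) auto
      then show ?thesis using \<open>0 < t\<close> h interior_time_domain[of "-h" t x] by auto
    qed
  qed (use N slope0 t in \<open>auto intro: closed_Times\<close>)
  then show ?thesis by (simp add: algebra_simps)
qed

text \<open>
Where \<open>x + c * t\<close> is bounded above, the rear estimate already gives decay at the rate \<open>\<gamma>\<close>, so its
values serve as lateral boundary values for the contraction near \<open>\<kappa>\<close>.
\<close>

lemma exponential_closeness_everywhere:
  assumes h: "h > 0" and c: "c > 0" and u: "classical_solution h g u" and p: "classical_solution h g p"
    and bound: "\<And>t x. -h \<le> t \<Longrightarrow> \<bar>u t x - p t x\<bar> \<le> B"
    and rear: "\<And>t x. -h \<le> t \<Longrightarrow> \<bar>u t x - p t x\<bar> \<le> K * exp (lam * (x + c * t) - \<gamma> * t)"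
    and K: "0 \<le> K" and lam: "0 < lam" and \<gamma>: "0 < \<gamma>"
    and r: "\<And>x y. \<bar>x - \<kappa>\<bar> \<le> r \<Longrightarrow> \<bar>y - \<kappa>\<bar> \<le> r \<Longrightarrow> \<bar>g x - g y\<bar> \<le> q * \<bar>x - y\<bar>" and q: "0 \<le> q"
    and rate: "q * exp (\<gamma> * h) \<le> 1 - \<gamma>"
    and near: "eventually (\<lambda>(t, x). \<bar>u t x - \<kappa>\<bar> \<le> r \<and> \<bar>p t x - \<kappa>\<bar> \<le> r) (behind_front c)"
  obtains M where "0 \<le> M" "\<And>t x. 0 \<le> t \<Longrightarrow> \<bar>u t x - p t x\<bar> \<le> M * exp (- \<gamma> * t)"
proof -
  obtain N where N: "N \<ge> 0" "\<And>t x. N \<le> t \<Longrightarrow> N \<le> x + c * t \<Longrightarrow> \<bar>u t x - \<kappa>\<bar> \<le> r \<and> \<bar>p t x - \<kappa>\<bar> \<le> r"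
    using near by (rule eventually_behind_frontE[where ?N0.0 = 0]) auto
  define M where "M = max (K * exp (lam * (N + c * h))) (\<bar>B\<bar> * exp (\<gamma> * (N + h)))"
  have M: "0 \<le> M" using K by (simp add: M_def max_def)
  have near_rear: "\<bar>u t x - p t x\<bar> \<le> M * exp (- \<gamma> * t)" if "-h \<le> t" "x + c * t \<le> N + c * h" for t x
  proof -
    have "lam * (x + c * t) \<le> lam * (N + c * h)" using that lam by (intro mult_left_mono) auto
    then have "K * exp (lam * (x + c * t) - \<gamma> * t) \<le> K * exp (lam * (N + c * h) - \<gamma> * t)"
      using K by (intro mult_left_mono) auto
    also have "\<dots> = K * exp (lam * (N + c * h)) * exp (- \<gamma> * t)"
      by (simp add: exp_diff exp_minus field_simps)
    also have "\<dots> \<le> M * exp (- \<gamma> * t)" by (intro mult_right_mono) (auto simp: M_def)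
    finally show ?thesis using rear[OF that(1), of x] by linarith
  qed
  have early: "\<bar>u t x - p t x\<bar> \<le> M * exp (- \<gamma> * t)" if "-h \<le> t" "t \<le> N + h" for t x
  proof -
    have "\<bar>B\<bar> * 1 \<le> \<bar>B\<bar> * exp (\<gamma> * (N + h) - \<gamma> * t)"
      using that \<gamma> by (intro mult_left_mono) auto
    also have "\<dots> = \<bar>B\<bar> * exp (\<gamma> * (N + h)) * exp (- \<gamma> * t)"
      by (simp add: exp_diff exp_minus field_simps)
    also have "\<dots> \<le> M * exp (- \<gamma> * t)" by (intro mult_right_mono) (auto simp: M_def)
    finally show ?thesis using bound[OF that(1), of x] by linarith
  qed
  define D where "D = moving_half_plane c N N"
  have D: "(t, x) \<in> D \<longleftrightarrow> N \<le> t \<and> N \<le> x + c * t" for t x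
    by (simp add: D_def moving_half_plane_def)
  have inside: "\<bar>u t x - p t x\<bar> \<le> M * exp (0 * x + (- \<gamma>) * t)" if "(t, x) \<in> D" for t x
  proof (rule exponential_difference_bound[OF h u p _ _ M q _ _ that])
    show "closed D" unfolding D_def by (rule closed_moving_half_plane)
    show "D \<subseteq> {-h..} \<times> UNIV" using N h by (auto simp: D)
    show "q * exp (- (- \<gamma> * h)) \<le> - \<gamma> - 0\<^sup>2 + 1" using rate by simp
    fix t x assume tx: "(t, x) \<in> D"
    show "\<bar>u t x - p t x\<bar> \<le> M * exp (0 * x + - \<gamma> * t) \<or>
       0 < t \<and> (t, x) \<in> interior D \<and> (t - h, x) \<in> D \<and>
       \<bar>g (u (t - h) x) - g (p (t - h) x)\<bar> \<le> q * \<bar>u (t - h) x - p (t - h) x\<bar>"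
    proof (cases "N + h < t \<and> N + c * h < x + c * t")
      case True
      have "0 < c * h" using c h by simp
      then have "(t, x) \<in> interior D" unfolding D_def using True h by (intro interior_moving_half_plane) auto
      moreover have d: "N \<le> t - h" "N \<le> x + c * (t - h)" using True by (simp_all add: right_diff_distrib)
      moreover have "\<bar>g (u (t - h) x) - g (p (t - h) x)\<bar> \<le> q * \<bar>u (t - h) x - p (t - h) x\<bar>"
        using N(2)[OF d] by (intro r) auto
      ultimately show ?thesis using N(1) h by (auto simp: D)
    next
      case False
      then show ?thesis using early[of t x] near_rear[of t x] tx N(1) h by (auto simp: D not_less)
    qed
  qed
  have "\<bar>u t x - p t x\<bar> \<le> M * exp (- \<gamma> * t)" if "0 \<le> t" for t x
  proof (cases "(t, x) \<in> D")
    case True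
    then show ?thesis using inside[OF True] by simp
  next
    case False
    then have "t \<le> N + h \<or> x + c * t \<le> N + c * h"
      using h mult_pos_pos[OF c h] by (simp add: D) linarith
    then show ?thesis using early[of t x] near_rear[of t x] that h by auto
  qed
  then show ?thesis using M that by blast
qed

end

section \<open>Stability of the wavefront\<close>

text \<open>
Any strict inequality between the coefficients of the stationary problem leaves room for a decay
rate; this one lemma supplies it both at the rear and near \<open>\<kappa>\<close>.
\<close>

lemma eventually_exponential_rate:
  fixes x y h :: real
  assumes "x < y"
  shows "eventually (\<lambda>\<gamma>. x * exp (\<gamma> * h) \<le> y - \<gamma>) (at_right 0)"
proof -
  have "((\<lambda>\<gamma>. y - \<gamma> - x * exp (\<gamma> * h)) \<longlongrightarrow> y - 0 - x * exp (0 * h)) (at_right 0)"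
    by (intro tendsto_intros)
  then have "eventually (\<lambda>\<gamma>. 0 < y - \<gamma> - x * exp (\<gamma> * h)) (at_right 0)"
    using assms by (intro order_tendstoD(1)) auto
  then show ?thesis by eventually_elim auto
qed

lemma exponential_decay_below:
  fixes R e \<gamma> :: real
  assumes "0 \<le> R" "0 < e" "0 < \<gamma>" "R / (e * \<gamma>) \<le> t"
  shows "R * exp (- \<gamma> * t) < e"
proof -
  have "R / e \<le> \<gamma> * t" using assms by (simp add: field_simps)
  also have "\<dots> < exp (\<gamma> * t)" using exp_ge_add_one_self[of "\<gamma> * t"] by linarith
  finally have "R < e * exp (\<gamma> * t)" using assms by (simp add: field_simps)
  then show ?thesis by (simp add: exp_minus field_simps)
qed

lemma eta_pos: "0 < eta lam t"
  by (simp add: eta_def)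

lemma weighted_difference_bounded:
  assumes "(SUP s\<in>S. weighted_norm lam (f s)) < \<infinity>"
  obtains N where "0 \<le> N" "\<And>s x. s \<in> S \<Longrightarrow> \<bar>f s x\<bar> \<le> N * eta lam x"
proof -
  obtain n :: nat where n: "(SUP s\<in>S. weighted_norm lam (f s)) < ereal (real n)"
    using assms less_PInf_Ex_of_nat[of "SUP s\<in>S. weighted_norm lam (f s)"] by auto
  show ?thesis
  proof (rule that[of "real n"])
    fix s x assume "s \<in> S"
    have "ereal (\<bar>f s x\<bar> / eta lam x) \<le> weighted_norm lam (f s)"
      unfolding weighted_norm_def by (rule SUP_upper) simp
    also have "\<dots> \<le> (SUP s\<in>S. weighted_norm lam (f s))" using \<open>s \<in> S\<close> by (rule SUP_upper)
    also have "\<dots> < ereal (real n)" by (rule n)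
    finally show "\<bar>f s x\<bar> \<le> real n * eta lam x" using eta_pos[of lam x] by (simp add: field_simps)
  qed simp
qed

lemma Liminf_at_top_pos:
  fixes f :: "real \<Rightarrow> ereal"
  assumes "Liminf at_top f > 0"
  obtains a X where "0 < a" "\<And>x. X \<le> x \<Longrightarrow> ereal a < f x"
proof -
  obtain a where a: "0 < ereal a" "ereal a < Liminf at_top f"
    using ereal_dense2[OF assms] by auto
  then have "eventually (\<lambda>x. ereal a < f x) at_top" by (intro less_LiminfD)
  then show ?thesis using that[of a] a unfolding eventually_at_top_linorder by auto
qed

lemma eventually_behind_front_profile:
  assumes "eventually P at_top"
  shows "eventually (\<lambda>(t, x). P (x + c * t)) (behind_front c)"
proof -
  obtain N where "\<And>z. N \<le> z \<Longrightarrow> P z" using assms unfolding eventually_at_top_linorder by blast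
  then show ?thesis unfolding eventually_behind_front by (intro exI[of _ N]) auto
qed

lemma profile_limit_from_front:
  assumes "((\<lambda>(t, x). \<phi> (x + c * t)) \<longlongrightarrow> l) (behind_front c)"
  shows "(\<phi> \<longlongrightarrow> l) at_top"
proof (rule topological_tendstoI)
  fix S assume "open S" "l \<in> S"
  then have "eventually (\<lambda>p. (case p of (t, x) \<Rightarrow> \<phi> (x + c * t)) \<in> S) (behind_front c)"
    by (rule topological_tendstoD[OF assms])
  then obtain N where N: "\<And>t x. N \<le> t \<Longrightarrow> N \<le> x + c * t \<Longrightarrow> \<phi> (x + c * t) \<in> S"
    unfolding eventually_behind_front by auto
  have "\<phi> z \<in> S" if "N \<le> z" for z using N[of N "z - c * N"] that by simp
  then show "eventually (\<lambda>z. \<phi> z \<in> S) at_top" unfolding eventually_at_top_linorder by blast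
qed

theorem corollary3:
  fixes h \<kappa> xm c lam :: real
    and g \<phi> :: "real \<Rightarrow> real"
    and w0 u :: "real \<Rightarrow> real \<Rightarrow> real"
  assumes "h > 0"
    and "hyp_UM \<kappa> g"
    and "xm \<in> {0<..<\<kappa>}"
    and "unimodal_at g xm"
    and "\<forall>x\<in>{g (g xm)..g xm}. g field_differentiable (at x) \<and> \<bar>deriv g x\<bar> < 1"
    and "initial_function h w0"
    and "IC1 h w0"
    and "IC2 h w0"
    and "c > c_sharp h g"
    and "lam \<in> {lambda1 h g c<..<lambda2 h g c}"
    and "semi_wavefront h g c \<phi>"
    and "(SUP s\<in>{-h..0}. weighted_norm lam (\<lambda>x. \<phi> (x + c * s) - w0 s x)) < \<infinity>"
    and "classical_solution h g u"
    and "\<forall>s\<in>{-h..0}. \<forall>x. u s x = w0 s x"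
  shows "wavefront h g \<kappa> c \<phi> \<and>
    uniform_limit UNIV (\<lambda>t x. u t x - \<phi> (x + c * t)) (\<lambda>x. 0) at_top \<and>
    (\<exists>\<rho>>0. \<exists>\<gamma>>0. \<forall>t\<ge>0.
       (SUP x. ereal (\<bar>u t x - \<phi> (x + c * t)\<bar> / eta lam (x + c * t)))
         \<le> ereal (0.5 * \<rho> * exp (- \<gamma> * t)))"
proof -
  interpret unimodal_birth \<kappa> xm g
    using assms(2-5) by unfold_locales
  note h = assms(1) and u = assms(13)
  have lam: "0 < c" "0 < lam" "chi0 h g c lam < 0"
    using chi0_neg_between_roots[OF slope0 h assms(9,10)] by auto
  define p where "p = (\<lambda>t x. \<phi> (x + c * t))"
  have p: "classical_solution h g p" and \<phi>_pos: "\<And>z. 0 < \<phi> z" and \<phi>_bounded: "bounded (range \<phi>)"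
    and \<phi>_smooth: "C2_smooth \<phi>" and \<phi>_liminf: "Liminf at_top (\<lambda>x. ereal (\<phi> x)) > 0"
    using assms(11) unfolding semi_wavefront_def p_def by auto
  have \<phi>_cont: "continuous_on S \<phi>" for S
    using \<phi>_smooth unfolding C2_smooth_def
    by (meson DERIV_isCont continuous_at_imp_continuous_on)

  obtain Bu where Bu: "\<And>t x. -h \<le> t \<Longrightarrow> t \<le> 0 \<Longrightarrow> \<bar>u t x\<bar> \<le> Bu"
    using classical_solution_bounded[OF u] by blast
  obtain Bg where Bg: "\<And>y. 0 \<le> y \<Longrightarrow> g y \<le> Bg" using g_bounded by blast
  obtain Bp where Bp: "\<And>z. \<bar>\<phi> z\<bar> \<le> Bp"
    using \<phi>_bounded unfolding bounded_iff by auto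
  define B where "B = max Bu Bg"
  have u_nonneg: "0 \<le> u t x" if "-h \<le> t" for t x
  proof (rule solution_nonneg[OF h u g_nonneg _ that])
    fix s x assume s: "s \<in> {-h..0}"
    have "0 \<le> w0 s x" using assms(6) s unfolding initial_function_def by blast
    then show "0 \<le> u s x" using assms(14) s by simp
  qed
  have u_le: "u t x \<le> B" if "-h \<le> t" for t x
  proof (rule solution_le[OF h u _ _ u_nonneg that])
    show "u s x \<le> B" if "s \<in> {-h..0}" for s x
      using Bu[of s x] that by (auto simp: B_def)
    show "g y \<le> B" if "0 \<le> y" for y using Bg[OF that] by (simp add: B_def)
  qed
  have p_nonneg: "0 \<le> p t x" for t x using \<phi>_pos by (simp add: p_def less_imp_le)
  have diff_bounded: "\<bar>u t x - p t x\<bar> \<le> B + Bp" if "-h \<le> t" for t x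
    using u_nonneg[OF that, of x] u_le[OF that, of x] p_nonneg[of t x] Bp[of "x + c * t"]
    by (auto simp: p_def)

  obtain r q where rq: "r > 0" "q < 1" "0 \<le> q"
    "\<And>x y. \<bar>x - \<kappa>\<bar> \<le> r \<Longrightarrow> \<bar>y - \<kappa>\<bar> \<le> r \<Longrightarrow> \<bar>g x - g y\<bar> \<le> q * \<bar>x - y\<bar>"
    using contraction_near_kappa by blast
  have "deriv g 0 * exp (- lam * c * h) < lam * c - lam\<^sup>2 + 1"
    using lam(3) by (simp add: chi0_def mult.commute)
  then have "eventually (\<lambda>\<gamma>. deriv g 0 * exp (- lam * c * h) * exp (\<gamma> * h) \<le> lam * c - lam\<^sup>2 + 1 - \<gamma>
       \<and> q * exp (\<gamma> * h) \<le> 1 - \<gamma> \<and> 0 < \<gamma>) (at_right 0)"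
    using rq(2) by (intro eventually_conj eventually_exponential_rate eventually_at_right_less)
  then obtain \<gamma> where \<gamma>: "0 < \<gamma>" "q * exp (\<gamma> * h) \<le> 1 - \<gamma>"
    "deriv g 0 * exp (- lam * c * h) * exp (\<gamma> * h) \<le> lam * c - lam\<^sup>2 + 1 - \<gamma>"
    by (auto dest!: eventually_happens)

  obtain N where N: "0 \<le> N"
    "\<And>s x. s \<in> {-h..0} \<Longrightarrow> \<bar>\<phi> (x + c * s) - w0 s x\<bar> \<le> N * eta lam x"
    using weighted_difference_bounded[OF assms(12)] by blast
  have init: "\<bar>u s x - p s x\<bar> \<le> N * exp (lam * x)" if s: "s \<in> {-h..0}" for s x
  proof -
    have "\<bar>u s x - p s x\<bar> \<le> N * eta lam x"
      using N(2)[OF s, of x] assms(14) s by (simp add: p_def abs_minus_commute)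
    also have "\<dots> \<le> N * exp (lam * x)" using N(1) by (intro mult_left_mono) (auto simp: eta_def)
    finally show ?thesis .
  qed
  define K where "K = N * exp (lam * c * h)"
  have K: "0 \<le> K" using N(1) by (simp add: K_def)
  have rear: "\<bar>u t x - p t x\<bar> \<le> K * exp (lam * (x + c * t) - \<gamma> * t)" if "-h \<le> t" for t x
    unfolding K_def
    using exponential_closeness_at_rear[OF h u p u_nonneg p_nonneg lam(1,2) _ N(1) \<gamma>(3) init that] \<gamma>(1)
    by simp

  obtain a Z where a: "0 < a" "\<And>z. Z \<le> z \<Longrightarrow> ereal a < ereal (\<phi> z)"
    using Liminf_at_top_pos[OF \<phi>_liminf] by blast
  have "eventually (\<lambda>z. a \<le> \<phi> z \<and> \<phi> z \<le> Bp) at_top"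
    using a(2) Bp unfolding eventually_at_top_linorder by (force simp: abs_le_iff)
  then have p_limit: "((\<lambda>(t, x). p t x) \<longlongrightarrow> \<kappa>) (behind_front c)"
    using converges_to_kappa_behind_front[OF h lam(1) p a(1), of Bp]
      eventually_behind_front_profile[of "\<lambda>z. a \<le> \<phi> z \<and> \<phi> z \<le> Bp" c] by (simp add: p_def)
  then have front: "wavefront h g \<kappa> c \<phi>"
    using profile_limit_from_front[of \<phi> c \<kappa>] assms(11) by (simp add: wavefront_def p_def)

  have "\<exists>z\<in>{- (c * h)..0}. \<forall>y\<in>{- (c * h)..0}. \<phi> z \<le> \<phi> y"
    using lam(1) h by (intro continuous_attains_inf \<phi>_cont) auto
  then obtain z0 where z0: "\<And>y. y \<in> {- (c * h)..0} \<Longrightarrow> \<phi> z0 \<le> \<phi> y" by blast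
  \<comment> \<open>Once the rear estimate is below half the minimum of the profile over this strip,
    \<open>u\<close> exceeds the other half.\<close>
  define b where "b = \<phi> z0 / 2"
  have b: "0 < b" "\<phi> z0 = 2 * b" using \<phi>_pos[of z0] by (auto simp: b_def)
  have boundary: "b \<le> u t x" if "K / (b * \<gamma>) \<le> t" "x + c * t \<in> {- (c * h)..0}" for t x
  proof -
    have "0 \<le> K / (b * \<gamma>)" using K b \<gamma> by simp
    then have t: "-h \<le> t" using that h by linarith
    have "lam * (x + c * t) \<le> 0" using that lam by (intro mult_nonneg_nonpos) auto
    then have "K * exp (lam * (x + c * t) - \<gamma> * t) \<le> K * exp (- \<gamma> * t)"
      using K by (intro mult_left_mono) auto
    also have "\<dots> < b" using K b \<gamma> that by (intro exponential_decay_below) auto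
    finally have "\<bar>u t x - p t x\<bar> < b" using rear[OF t, of x] by linarith
    moreover have "2 * b \<le> p t x" using z0[OF that(2)] b by (simp add: p_def)
    ultimately show ?thesis by linarith
  qed
  obtain a0 X where a0: "0 < a0" "\<And>x. X \<le> x \<Longrightarrow> ereal a0 < (INF s\<in>{-h..0}. ereal (w0 s x))"
    using Liminf_at_top_pos[of "\<lambda>x. INF s\<in>{-h..0}. ereal (w0 s x)"] assms(8)
    unfolding IC2_def by blast
  have u0: "a0 \<le> u 0 x" if "X \<le> x" for x
  proof -
    have "ereal a0 < ereal (w0 0 x)"
      using a0(2)[OF that] by (rule less_le_trans) (use h in \<open>auto intro: INF_lower\<close>)
    then show ?thesis using assms(14) h by simp
  qed
  obtain a' where a': "0 < a'" "eventually (\<lambda>(t, x). a' \<le> u t x) (behind_front c)"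
    using persistence[OF h lam(1) u _ u0 a0(1) boundary b(1), of B] u_nonneg u_le by blast
  have "eventually (\<lambda>(t, x). 0 \<le> t) (behind_front c)" unfolding eventually_behind_front by auto
  with a'(2) have "eventually (\<lambda>(t, x). a' \<le> u t x \<and> u t x \<le> B) (behind_front c)"
    by eventually_elim (use u_le h in auto)
  then have u_limit: "((\<lambda>(t, x). u t x) \<longlongrightarrow> \<kappa>) (behind_front c)"
    by (rule converges_to_kappa_behind_front[OF h lam(1) u a'(1)])

  have "eventually (\<lambda>(t, x). \<bar>u t x - \<kappa>\<bar> \<le> r \<and> \<bar>p t x - \<kappa>\<bar> \<le> r) (behind_front c)"
    using tendstoD[OF u_limit rq(1)] tendstoD[OF p_limit rq(1)]
    by eventually_elim (auto simp: dist_real_def)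
  then obtain M where M: "0 \<le> M" "\<And>t x. 0 \<le> t \<Longrightarrow> \<bar>u t x - p t x\<bar> \<le> M * exp (- \<gamma> * t)"
    using exponential_closeness_everywhere[OF h lam(1) u p diff_bounded rear K lam(2) \<gamma>(1) rq(4,3) \<gamma>(2)]
    by blast

  have "uniform_limit UNIV (\<lambda>t x. u t x - \<phi> (x + c * t)) (\<lambda>x. 0) at_top"
    unfolding uniform_limit_iff
  proof (intro allI impI)
    fix e :: real assume "e > 0"
    have "eventually (\<lambda>t. max 0 (M / (e * \<gamma>)) \<le> t) at_top" by (rule eventually_ge_at_top)
    then show "eventually (\<lambda>t. \<forall>x\<in>UNIV. dist (u t x - \<phi> (x + c * t)) 0 < e) at_top"
    proof eventually_elim
      case (elim t)
      then have "M * exp (- \<gamma> * t) < e" using M(1) \<open>e > 0\<close> \<gamma> by (intro exponential_decay_below) auto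
      moreover have "\<bar>u t x - \<phi> (x + c * t)\<bar> \<le> M * exp (- \<gamma> * t)" for x
        using M(2)[of t x] elim by (simp add: p_def)
      ultimately show ?case by (auto intro: le_less_trans)
    qed
  qed
  moreover have "(SUP x. ereal (\<bar>u t x - \<phi> (x + c * t)\<bar> / eta lam (x + c * t)))
       \<le> ereal (0.5 * (2 * (K + M + 1)) * exp (- \<gamma> * t))" if t: "0 \<le> t" for t
  proof (rule SUP_least)
    fix x
    define z where "z = x + c * t"
    have "\<bar>u t x - \<phi> z\<bar> \<le> K * exp (lam * z - \<gamma> * t)"
      using rear[of t x] t h by (simp add: p_def z_def)
    also have "\<dots> = K * exp (- \<gamma> * t) * exp (lam * z)" by (simp add: exp_diff exp_minus field_simps)
    also have "\<dots> \<le> (K + M + 1) * exp (- \<gamma> * t) * exp (lam * z)"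
      using M(1) by (intro mult_right_mono) auto
    finally have 1: "\<bar>u t x - \<phi> z\<bar> \<le> (K + M + 1) * exp (- \<gamma> * t) * exp (lam * z)" .
    have "\<bar>u t x - \<phi> z\<bar> \<le> M * exp (- \<gamma> * t)" using M(2)[OF t, of x] by (simp add: p_def z_def)
    also have "\<dots> \<le> (K + M + 1) * exp (- \<gamma> * t)" using K by (intro mult_right_mono) auto
    finally have "\<bar>u t x - \<phi> z\<bar> \<le> (K + M + 1) * exp (- \<gamma> * t) * eta lam z"
      using 1 by (simp add: eta_def min_def)
    then show "ereal (\<bar>u t x - \<phi> (x + c * t)\<bar> / eta lam (x + c * t))
        \<le> ereal (0.5 * (2 * (K + M + 1)) * exp (- \<gamma> * t))"
      using eta_pos[of lam z] by (simp add: z_def[symmetric] field_simps)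
  qed
  moreover have "0 < 2 * (K + M + 1)" using K M(1) by simp
  ultimately show ?thesis using front \<gamma>(1) by blast
qed

end
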